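(* Let $k\ge1$ be an integer, $\lambda,\mu>0$, $\theta>0$, $\alpha\in(0,1)$. The inter-phase times $\mathcal{P}^{\theta,\alpha}$ of the tempered Erlang queue are independent and identically distributed with \begin{equation*} \Pr(\mathcal{P}^{\theta,\alpha}>t)=e^{-\theta t}\sum_{q=0}^{\infty}(\theta t)^q\sum_{r=0}^{\infty}(-k\mu t^\alpha)^rE_{\alpha, r\alpha+q+1}^r(\theta^\alpha t^\alpha),\qquad t\ge0. \end{equation*}
   Context: Erlang queue: $\{Q(t)\}_{t\ge0}$, $Q(t)=(N(t),S(t))$, with $N(t)$ the number of customers and $S(t)$ the phase of the customer in service, where customers arrive according to a Poisson process of rate $\lambda$ and the service of each customer consists of $k$ successive phases, each with exponential duration of rate $k\mu$. Let $D_{\theta,\alpha}$ be the subordinator with $\mathbb{E}e^{-sD_{\theta,\alpha}(t)}=e^{-t((s+\theta)^\alpha-\theta^\alpha)}$ and $Y_{\theta,\alpha}(t)=\inf\{x>0:D_{\theta,\alpha}(x)>t\}$, independent of $Q$; the tempered Erlang queue is $Q^{\theta,\alpha}(t)=Q(Y_{\theta,\alpha}(t))$. An inter-phase time of $Q^{\theta,\alpha}$ is the time, measured on the clock $t$ of $Q^{\theta,\alpha}$, between the start and the completion of a service phase (i.e. if a phase occupies the interval $[\sigma,\sigma+E)$ of the time of $Q$, the corresponding inter-phase time is the length of $\{t\ge0: Y_{\theta,\alpha}(t)\in[\sigma,\sigma+E)\}$). Three-parameter Mittag-Leffler function: $E_{\alpha,b}^{\gamma}(x)=\sum_{j\ge0}\frac{(\gamma)_j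 x^j}{j!\Gamma(\alpha j+b)}$ with Pochhammer symbol $(\gamma)_j$, $(\gamma)_0=1$ (so $E^0_{\alpha,b}(x)=1/\Gamma(b)$). *)

theory Defs
  imports "HOL-Probability.Probability"
begin

definition ML3 :: "real \<Rightarrow> real \<Rightarrow> real \<Rightarrow> real \<Rightarrow> real" where
  "ML3 a b g x = (\<Sum>j. pochhammer g j * x ^ j / (fact j * Gamma (a * real j + b)))"

definition tempered_stable_subordinator ::
  "'a measure \<Rightarrow> real \<Rightarrow> real \<Rightarrow> (real \<Rightarrow> 'a \<Rightarrow> real) \<Rightarrow> bool" where
  "tempered_stable_subordinator M \<theta> \<alpha> D \<longleftrightarrow>
     (\<forall>t. D t \<in> borel_measurable M) \<and>
     (\<forall>\<omega>\<in>space M. D 0 \<omega> = 0 \<and> mono_on {0..} (\<lambda>t. D t \<omega>) \<and>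
        (\<forall>t\<ge>0. continuous (at_right t) (\<lambda>s. D s \<omega>))) \<and>
     (\<forall>ts::real list. sorted ts \<and> (\<forall>t\<in>set ts. 0 \<le> t) \<longrightarrow>
        prob_space.indep_vars M (\<lambda>_. borel) (\<lambda>i \<omega>. D (ts ! Suc i) \<omega> - D (ts ! i) \<omega>)
          {..<length ts - 1}) \<and>
     (\<forall>s t. 0 \<le> s \<longrightarrow> 0 \<le> t \<longrightarrow>
        distr M borel (\<lambda>\<omega>. D (s + t) \<omega> - D s \<omega>) = distr M borel (D t)) \<and>
     (\<forall>s t. 0 \<le> s \<longrightarrow> 0 \<le> t \<longrightarrow>
        prob_space.expectation M (\<lambda>\<omega>. exp (- s * D t \<omega>))
          = exp (- t * ((s + \<theta>) powr \<alpha> - \<theta> powr \<alpha>)))"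

definition inv_sub :: "(real \<Rightarrow> 'a \<Rightarrow> real) \<Rightarrow> real \<Rightarrow> 'a \<Rightarrow> real" where
  "inv_sub D t \<omega> = Inf {x. 0 < x \<and> D x \<omega> > t}"

text \<open>Erlang queue (single server, FIFO, initially empty): customer m (m = 0,1,...)
  arrives at time T m; phase n (n = 0,1,...) is phase (n mod k) of customer (n div k)
  and has duration E n. phase_start k T E n is the start time of phase n.\<close>
fun phase_start :: "nat \<Rightarrow> (nat \<Rightarrow> real) \<Rightarrow> (nat \<Rightarrow> real) \<Rightarrow> nat \<Rightarrow> real" where
  "phase_start k T E 0 = T 0"
| "phase_start k T E (Suc n) =
     (if Suc n mod k = 0 then max (T (Suc n div k)) (phase_start k T E n + E n)
      else phase_start k T E n + E n)"

definition arrival_times :: "(nat \<Rightarrow> 'a \<Rightarrow> real) \<Rightarrow> 'a \<Rightarrow> nat \<Rightarrow> real" where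
  "arrival_times X \<omega> m = (\<Sum>i\<le>m. X i \<omega>)"

text \<open>Inter-phase time of the n-th phase of the tempered queue Q(Y(t)).\<close>
definition inter_phase_time ::
  "nat \<Rightarrow> (nat \<Rightarrow> 'a \<Rightarrow> real) \<Rightarrow> (nat \<Rightarrow> 'a \<Rightarrow> real) \<Rightarrow> (real \<Rightarrow> 'a \<Rightarrow> real)
     \<Rightarrow> nat \<Rightarrow> 'a \<Rightarrow> real" where
  "inter_phase_time k X E D n \<omega> =
     (let \<sigma> = phase_start k (arrival_times X \<omega>) (\<lambda>i. E i \<omega>) n
      in measure lborel {t. 0 \<le> t \<and> inv_sub D t \<omega> \<in> {\<sigma> ..< \<sigma> + E n \<omega>}})"

end

theory Submission
  imports Defs
begin

text \<open>
  The \<open>n\<close>-th inter-phase time is almost surely the increment \<open>D((\<sigma>\<^sub>n + E\<^sub>n)-) - D(\<sigma>\<^sub>n-)\<close>, where \<open>\<sigma>\<^sub>n\<close>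
  is the start of the phase on the clock of the untempered queue. Conditionally on the queue these are increments over
  disjoint deterministic intervals, hence independent with the laws of \<open>D(E\<^sub>n)\<close>; integrating over the
  independent \<open>E\<^sub>n\<close> gives the i.i.d. property and the Laplace transform \<open>\<beta> / (\<beta> + \<psi>(s))\<close> with
  \<open>\<beta> = k\<mu>\<close> and \<open>\<psi>(s) = (s + \<theta>)\<^sup>\<alpha> - \<theta>\<^sup>\<alpha>\<close>. For large \<open>s\<close> the tail and the triple series have the same
  Laplace transform \<open>\<psi>(s) / (s (\<beta> + \<psi>(s)))\<close>: put \<open>w = s + \<theta>\<close> and sum over \<open>j\<close> by the negative binomial
  series, over \<open>r\<close> and \<open>q\<close> by geometric series. Both functions being right-continuous, they agree.
\<close>

text \<open>Both independent inputs live on one space \<open>M\<close> without product structure, so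
  conditioning on the queue is done by Fubini on the diagonal: an integral of f(x, x) becomes a
  double integral in which x drives the queue and y the subordinator. Measurability must therefore
  be tracked for the two generated sigma-algebras, and jointly in time and path because the phase
  starts are random. Since \<open>measure\<close> and \<open>Inf\<close> take default values on
  exceptional paths, the inter-phase time is computed on every path and simplified almost surely
  afterwards. Large s is forced by the sum over r, a geometric series of ratio -\<beta>/\<psi>(s),
  which converges only if \<psi>(s) > \<beta>. Agreement of the transforms on a progression s0 + m,
  m = 0, 1, ..., is enough: once the difference is weighted by exp(-s0 t), these values are
  integrals against powers of exp(-t), and polynomials are dense in the continuous functions on
  [0,1].\<close>

section \<open>Independence\<close>

text \<open>Independence of two sub-sigma-algebras means that the map x to (x, x) into their product
  has the product law; Fubini then takes the place of conditional expectation. The price is that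
  \<open>f\<close> must be measurable for the two small sigma-algebras, not just for
  \<open>M\<close>.\<close>

lemma (in prob_space) nn_integral_indep_diagonal:
  assumes ind: "indep_set (sigma_sets (space M) A) (sigma_sets (space M) B)"
    and f[measurable]: "f \<in> borel_measurable (sigma (space M) A \<Otimes>\<^sub>M sigma (space M) B)"
  shows "(\<integral>\<^sup>+\<omega>. f (\<omega>, \<omega>) \<partial>M) = (\<integral>\<^sup>+x. \<integral>\<^sup>+y. f (x, y) \<partial>M \<partial>M)"
proof -
  let ?A = "sigma (space M) A" and ?B = "sigma (space M) B"
  have sub: "A \<subseteq> Pow (space M)" "B \<subseteq> Pow (space M)"
    using order_trans[OF sigma_sets_superset_generator indep_setD_ev1[OF ind]]
      order_trans[OF sigma_sets_superset_generator indep_setD_ev2[OF ind]] sets.space_closed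
    by (auto dest!: subsetD[of _ "sets M"] dest: sets.sets_into_space)
  have gen: "{a \<inter> space M |a. a \<in> sigma_sets (space M) C} = sigma_sets (space M) C"
    if "C \<subseteq> Pow (space M)" for C
  proof -
    have "a \<subseteq> space M" if "a \<in> sigma_sets (space M) C" for a
      using sigma_sets_into_sp[OF \<open>C \<subseteq> _\<close> that] .
    then show ?thesis by (fastforce simp: Int_absorb2)
  qed
  have idA[measurable]: "(\<lambda>x. x) \<in> M \<rightarrow>\<^sub>M ?A" and idB[measurable]: "(\<lambda>x. x) \<in> M \<rightarrow>\<^sub>M ?B"
    using indep_setD_ev1[OF ind] indep_setD_ev2[OF ind] sub
    by (auto intro!: measurable_measure_of)
  have "indep_var ?A (\<lambda>x. x) ?B (\<lambda>x. x)"
    unfolding indep_var_eq using ind sub idA idB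
    by (simp add: gen sigma_sets_sigma_sets_eq)
  then have eq: "distr M ?A (\<lambda>x. x) \<Otimes>\<^sub>M distr M ?B (\<lambda>x. x) = distr M (?A \<Otimes>\<^sub>M ?B) (\<lambda>x. (x, x))"
    by (simp add: indep_var_distribution_eq)
  interpret B: prob_space "distr M ?B (\<lambda>x. x)" by (rule prob_space_distr) measurable
  have [measurable]: "(\<lambda>x. \<integral>\<^sup>+y. f (x, y) \<partial>distr M ?B (\<lambda>x. x)) \<in> borel_measurable ?A"
    by measurable
  have "(\<integral>\<^sup>+\<omega>. f (\<omega>, \<omega>) \<partial>M) = (\<integral>\<^sup>+z. f z \<partial>distr M (?A \<Otimes>\<^sub>M ?B) (\<lambda>x. (x, x)))"
    by (subst nn_integral_distr) auto
  also have "\<dots> = (\<integral>\<^sup>+x. \<integral>\<^sup>+y. f (x, y) \<partial>distr M ?B (\<lambda>x. x) \<partial>distr M ?A (\<lambda>x. x))"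
    unfolding eq[symmetric] by (subst B.nn_integral_fst) auto
  also have "\<dots> = (\<integral>\<^sup>+x. \<integral>\<^sup>+y. f (x, y) \<partial>distr M ?B (\<lambda>x. x) \<partial>M)"
    by (subst nn_integral_distr) auto
  also have "\<dots> = (\<integral>\<^sup>+x. \<integral>\<^sup>+y. f (x, y) \<partial>M \<partial>M)"
    by (intro nn_integral_cong nn_integral_distr) (auto simp: space_measure_of)
  finally show ?thesis .
qed

text \<open>This extracts the independence of the durations from the family over
  \<open>nat + nat\<close>, with \<open>f\<close> equal to \<open>Inr\<close>. Events are
  transported to the image index set by the inverse of \<open>f\<close>.\<close>

lemma (in prob_space) indep_vars_reindex:
  assumes f: "inj_on f I" and X: "indep_vars M' X (f ` I)"
  shows "indep_vars (\<lambda>i. M' (f i)) (\<lambda>i. X (f i)) I"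
  unfolding indep_vars_def2
proof (intro conjI ballI indep_setsI)
  fix A J
  assume J: "J \<noteq> {}" "J \<subseteq> I" "finite J"
    and A: "\<forall>j\<in>J. A j \<in> {X (f j) -` B \<inter> space M |B. B \<in> sets (M' (f j))}"
  define A' where "A' i = A (the_inv_into I f i)" for i
  have A': "A' (f j) = A j" if "j \<in> J" for j
    using the_inv_into_f_f[OF f] that J by (auto simp: A'_def)
  have "indep_sets (\<lambda>i. {X i -` B \<inter> space M |B. B \<in> sets (M' i)}) (f ` I)"
    using X by (simp add: indep_vars_def2)
  then have "prob (\<Inter>i\<in>f ` J. A' i) = (\<Prod>i\<in>f ` J. prob (A' i))"
    by (rule indep_setsD) (use A A' J in auto)
  also have "\<dots> = (\<Prod>j\<in>J. prob (A j))"
    using inj_on_subset[OF f J(2)] A' by (simp add: prod.reindex)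
  finally show "prob (\<Inter>j\<in>J. A j) = (\<Prod>j\<in>J. prob (A j))" using A' by simp
qed (use X in \<open>auto simp: indep_vars_def2\<close>)

section \<open>Left limits and the inverse of a subordinator\<close>

text \<open>The times at which the inverse subordinator lies in \<open>[a, b)\<close> form the interval \<open>[D(a-), D(b-))\<close>, so
  left limits enter. The inserted 0 makes the supremum meaningful for \<open>a \<le> 0\<close>.\<close>

definition left_lim :: "(real \<Rightarrow> real) \<Rightarrow> real \<Rightarrow> real" where
  "left_lim f a = Sup (insert 0 (f ` {0<..<a}))"

lemma bdd_above_left_lim:
  fixes f :: "real \<Rightarrow> real"
  assumes "mono_on {0..} f"
  shows "bdd_above (insert (0::real) (f ` {0<..<a}))"
proof -
  have "f x \<le> f a" if "x \<in> {0<..<a}" for x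
    using that by (auto intro: mono_onD[OF assms])
  then show ?thesis by (auto intro!: bdd_aboveI2[where M = "f a"])
qed

lemma less_left_lim_iff:
  assumes "mono_on {0..} f"
  shows "t < left_lim f a \<longleftrightarrow> t < 0 \<or> (\<exists>x>0. x < a \<and> t < f x)"
  unfolding left_lim_def
  by (subst less_cSup_iff[OF _ bdd_above_left_lim[OF assms]]) auto

text \<open>Rational witnesses suffice because the path is monotone, so the level sets of the left
  limit become countable unions.\<close>

lemma less_left_lim_iff_Rats:
  assumes "mono_on {0..} f"
  shows "t < left_lim f a \<longleftrightarrow> t < 0 \<or> (\<exists>q\<in>\<rat>. 0 < q \<and> q < a \<and> t < f q)"
proof -
  have "\<exists>q\<in>\<rat>. 0 < q \<and> q < a \<and> t < f q" if x: "0 < x" "x < a" "t < f x" for x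
  proof -
    obtain q where "q \<in> \<rat>" "x < q" "q < a" using Rats_dense_in_real[OF x(2)] by auto
    moreover have "f x \<le> f q" using x calculation by (intro mono_onD[OF assms]) auto
    ultimately show ?thesis using x by (intro bexI[of _ q]) auto
  qed
  then show ?thesis unfolding less_left_lim_iff[OF assms] by auto
qed

text \<open>The evaluation time \<open>a\<close> is itself random, and time and path may come from
  different coordinates of \<open>N\<close>; the map \<open>g\<close> selects the path.\<close>

lemma measurable_left_lim:
  assumes [measurable]: "a \<in> borel_measurable N" "g \<in> N \<rightarrow>\<^sub>M M" "\<And>t. D t \<in> borel_measurable M"
    and mono: "\<And>\<omega>. \<omega> \<in> space M \<Longrightarrow> mono_on {0..} (\<lambda>t. D t \<omega>)"
  shows "(\<lambda>x. left_lim (\<lambda>t. D t (g x)) (a x)) \<in> borel_measurable N"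
  unfolding borel_measurable_iff_greater
proof
  fix t
  have "{w \<in> space N. t < left_lim (\<lambda>t. D t (g w)) (a w)} =
     {w \<in> space N. t < 0 \<or> (\<exists>q\<in>\<rat>. 0 < q \<and> q < a w \<and> t < D q (g w))}"
    using mono measurable_space[OF assms(2)] by (auto simp: less_left_lim_iff_Rats)
  also have "\<dots> \<in> sets N"
    using countable_rat by measurable
  finally show "{w \<in> space N. t < left_lim (\<lambda>t. D t (g w)) (a w)} \<in> sets N" .
qed

lemma left_lim_nonneg:
  assumes "mono_on {0..} f"
  shows "0 \<le> left_lim f a"
  unfolding left_lim_def by (rule cSup_upper[OF _ bdd_above_left_lim[OF assms]]) auto

lemma le_left_lim:
  assumes "mono_on {0..} f" "0 < x" "x < a"
  shows "f x \<le> left_lim f a"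
  unfolding left_lim_def by (rule cSup_upper[OF _ bdd_above_left_lim[OF assms(1)]]) (use assms in auto)

lemma left_lim_mono:
  assumes "mono_on {0..} f" "a \<le> b"
  shows "left_lim f a \<le> left_lim f b"
  unfolding left_lim_def using assms(2)
  by (intro cSup_subset_mono bdd_above_left_lim[OF assms(1)]) auto

lemma left_lim_le:
  assumes "mono_on {0..} f" "f 0 = 0" "0 \<le> a"
  shows "left_lim f a \<le> f a"
proof -
  have "f x \<le> f a" if "0 \<le> x" "x \<le> a" for x
    using that by (intro mono_onD[OF assms(1)]) auto
  then show ?thesis
    unfolding left_lim_def using assms(2,3) by (intro cSup_least) (auto, metis order_refl)
qed

text \<open>The hypothesis guarantees that the level t is passed: otherwise the infimum is over the
  empty set and has no meaningful value.\<close>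

lemma inv_sub_less_iff:
  assumes "\<exists>x>0. t < D x \<omega>"
  shows "inv_sub D t \<omega> < a \<longleftrightarrow> (\<exists>x>0. x < a \<and> t < D x \<omega>)"
  unfolding inv_sub_def using assms
  by (subst cInf_less_iff) (auto intro!: bdd_belowI[of _ 0])

text \<open>If the path is bounded, \<open>inv_sub\<close> takes the junk value \<open>Inf {}\<close> at all late times; when that value
  lies in the interval, the level set has infinite measure and hence \<open>measure\<close> 0.\<close>

lemma measure_inv_sub_interval:
  assumes mono: "mono_on {0..} (\<lambda>t. D t \<omega>)"
  shows "measure lborel {t. 0 \<le> t \<and> inv_sub D t \<omega> \<in> {a..<b}} =
    (if a < b \<and> ((\<forall>B::nat. \<exists>m::nat. B < D m \<omega>) \<or> Inf {} \<notin> {a..<b})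
     then left_lim (\<lambda>t. D t \<omega>) b - left_lim (\<lambda>t. D t \<omega>) a else 0)"
proof (cases "a < b")
  case ab: True
  define S where "S = {t. 0 \<le> t \<and> inv_sub D t \<omega> \<in> {a..<b}}"
  define I where "I = {left_lim (\<lambda>t. D t \<omega>) a..<left_lim (\<lambda>t. D t \<omega>) b}"
  have nn: "0 \<le> left_lim (\<lambda>t. D t \<omega>) a" by (rule left_lim_nonneg[OF mono])
  \<comment> \<open>At a level that the path exceeds, the inverse being at least a and below b reads
    D(a-) <= t and t < D(b-).\<close>
  have inI: "t \<in> S \<longleftrightarrow> t \<in> I" if t: "0 \<le> t" "\<exists>x>0. t < D x \<omega>" for t
    using t unfolding S_def I_def
    by (simp add: not_less[symmetric] inv_sub_less_iff[where D=D, OF t(2)]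
        less_left_lim_iff[OF mono])
  have I: "0 \<le> t \<and> (\<exists>x>0. t < D x \<omega>)" if "t \<in> I" for t
    using that nn unfolding I_def by (auto simp: less_left_lim_iff[OF mono])
  have J: "t \<in> S \<longleftrightarrow> Inf {} \<in> {a..<b}" if "0 \<le> t" "\<not> (\<exists>x>0. t < D x \<omega>)" for t
  proof -
    have "{x. 0 < x \<and> D x \<omega> > t} = {}" using that by auto
    then show ?thesis using that(1) unfolding S_def inv_sub_def by (simp del: Collect_empty_eq)
  qed
  have Snn: "0 \<le> t" if "t \<in> S" for t using that by (auto simp: S_def)
  show ?thesis
  proof (cases "(\<forall>B::nat. \<exists>m::nat. B < D m \<omega>) \<or> Inf {} \<notin> {a..<b}")
    case True
    have "S = I"
    proof (cases "Inf {} \<notin> {a..<b}")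
      case True
      then show ?thesis using inI I J Snn by blast
    next
      case False
      then have unb: "\<exists>m::nat. B < D m \<omega>" for B::nat using True by blast
      have "\<exists>x>0. t < D x \<omega>" for t
      proof -
        obtain B :: nat where "t < B" using reals_Archimedean2 by blast
        moreover obtain m :: nat where "B < D m \<omega>" using unb by blast
        moreover have "D m \<omega> \<le> D (real m + 1) \<omega>" by (intro mono_onD[OF mono]) auto
        ultimately show ?thesis by (intro exI[of _ "real m + 1"]) auto
      qed
      then show ?thesis using inI I Snn by blast
    qed
    then show ?thesis using True ab left_lim_mono[OF mono less_imp_le[OF ab]]
      unfolding S_def[symmetric] by (simp add: I_def)
  next
    case False
    then obtain B::nat where B: "\<And>m::nat. D m \<omega> \<le> B" by (auto simp: not_less)
    have "\<not> (\<exists>x>0. t < D x \<omega>)" if "B \<le> t" for t :: real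
    proof (intro notI, elim exE conjE)
      fix x :: real assume x: "0 < x" "t < D x \<omega>"
      obtain m::nat where m: "x \<le> m" using real_arch_simple by blast
      have "D x \<omega> \<le> D m \<omega>" using x m by (intro mono_onD[OF mono]) auto
      then show False using x B[of m] that by simp
    qed
    \<comment> \<open>No level from \<open>B\<close> on is exceeded, so there the inverse has the
      constant value \<open>Inf {}\<close>, which lies in the interval.\<close>
    then have "{real B..} \<subseteq> S" using J False by auto
    have "emeasure lborel {real B..} = \<infinity>"
    proof -
      have "ennreal (real n) \<le> emeasure lborel {real B..}" for n
      proof -
        have "emeasure lborel {real B..real B + real n} \<le> emeasure lborel {real B..}"
          by (intro emeasure_mono) auto
        then show ?thesis by simp
      qed
      then show ?thesis
        by (metis ennreal_Ex_less_of_nat infinity_ennreal_def linorder_not_less ennreal_of_nat_eq_real_of_nat top.not_eq_extremum)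
    qed
    \<comment> \<open>\<open>emeasure_mono\<close> needs the larger set to be measurable; writing
      \<open>S\<close> as the union of an interval and a half-line supplies this. The infinite
      measure then becomes 0 under \<open>measure\<close>.\<close>
    moreover have "S = I \<union> {t. 0 \<le> t \<and> \<not> (\<exists>x>0. t < D x \<omega>)}"
      using inI I J Snn False by blast
    moreover have "{t. 0 \<le> t \<and> \<not> (\<exists>x>0. t < D x \<omega>)} = {Sup (insert 0 ((\<lambda>x. D x \<omega>) ` {0<..}))..}"
    proof -
      have "bdd_above (insert 0 ((\<lambda>x. D x \<omega>) ` {0<..}))"
      proof -
        have "D x \<omega> \<le> B" if "0 < x" for x
        proof -
          obtain m::nat where m: "x \<le> m" using real_arch_simple by blast
          have "D x \<omega> \<le> D m \<omega>" using that m by (intro mono_onD[OF mono]) auto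
          then show ?thesis using B[of m] by simp
        qed
        then show ?thesis by (auto intro!: bdd_aboveI2)
      qed
      then have "(Sup (insert 0 ((\<lambda>x. D x \<omega>) ` {0<..})) \<le> t) \<longleftrightarrow> 0 \<le> t \<and> (\<forall>x>0. D x \<omega> \<le> t)" for t
        by (subst cSup_le_iff) auto
      then show ?thesis by (auto simp: not_less) (metis not_le)+
    qed
    ultimately have "S \<in> sets lborel" by (simp add: I_def)
    then have "emeasure lborel S = \<infinity>"
      using emeasure_mono[OF \<open>{real B..} \<subseteq> S\<close>, of lborel] \<open>emeasure lborel {real B..} = \<infinity>\<close>
      by (simp add: top.extremum_unique)
    then show ?thesis using False unfolding S_def[symmetric] by (auto simp: measure_def)
  qed
qed auto

section \<open>The tempered stable subordinator\<close>

locale tempered_stable = prob_space M for M :: "'a measure" +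
  fixes \<theta> \<alpha> :: real and D :: "real \<Rightarrow> 'a \<Rightarrow> real"
  assumes subordinator: "tempered_stable_subordinator M \<theta> \<alpha> D"
    and theta_pos: "0 < \<theta>" and alpha_pos: "0 < \<alpha>"
begin

definition \<psi> :: "real \<Rightarrow> real" where
  "\<psi> s = (s + \<theta>) powr \<alpha> - \<theta> powr \<alpha>"

lemma psi_pos: "0 < s \<Longrightarrow> 0 < \<psi> s"
  using theta_pos alpha_pos by (simp add: \<psi>_def powr_less_mono2)

lemma D_measurable[measurable]: "D t \<in> borel_measurable M"
  using subordinator by (simp add: tempered_stable_subordinator_def)

lemma mono_on_D: "\<omega> \<in> space M \<Longrightarrow> mono_on {0..} (\<lambda>t. D t \<omega>)"
  using subordinator by (simp add: tempered_stable_subordinator_def)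

lemma D_0: "\<omega> \<in> space M \<Longrightarrow> D 0 \<omega> = 0"
  using subordinator by (simp add: tempered_stable_subordinator_def)

lemma D_mono: "\<omega> \<in> space M \<Longrightarrow> 0 \<le> s \<Longrightarrow> s \<le> t \<Longrightarrow> D s \<omega> \<le> D t \<omega>"
  using mono_onD[OF mono_on_D, of \<omega> s t] by simp

lemma D_nonneg: "\<omega> \<in> space M \<Longrightarrow> 0 \<le> t \<Longrightarrow> 0 \<le> D t \<omega>"
  using D_mono[of \<omega> 0 t] by (simp add: D_0)

lemma expectation_exp_D:
  assumes "0 \<le> s" "0 \<le> t"
  shows "expectation (\<lambda>\<omega>. exp (- s * D t \<omega>)) = exp (- t * \<psi> s)"
  using subordinator assms unfolding tempered_stable_subordinator_def \<psi>_def by blast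

lemma distr_increment:
  assumes "0 \<le> s" "s \<le> t"
  shows "distr M borel (\<lambda>\<omega>. D t \<omega> - D s \<omega>) = distr M borel (D (t - s))"
proof -
  have "\<forall>s t. 0 \<le> s \<longrightarrow> 0 \<le> t \<longrightarrow>
        distr M borel (\<lambda>\<omega>. D (s + t) \<omega> - D s \<omega>) = distr M borel (D t)"
    using subordinator unfolding tempered_stable_subordinator_def by blast
  from this[rule_format, of s "t - s"] show ?thesis using assms by simp
qed

lemma expectation_exp_increment:
  assumes "0 \<le> u" "0 \<le> s" "s \<le> t"
  shows "expectation (\<lambda>\<omega>. exp (- u * (D t \<omega> - D s \<omega>))) = exp (- (t - s) * \<psi> u)"
proof -
  have "expectation (\<lambda>\<omega>. exp (- u * (D t \<omega> - D s \<omega>))) =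
      (\<integral>x. exp (- u * x) \<partial>distr M borel (\<lambda>\<omega>. D t \<omega> - D s \<omega>))"
    by (subst integral_distr) auto
  also have "\<dots> = expectation (\<lambda>\<omega>. exp (- u * D (t - s) \<omega>))"
    unfolding distr_increment[OF assms(2,3)] by (subst integral_distr) auto
  also have "\<dots> = exp (- (t - s) * \<psi> u)"
    using assms by (intro expectation_exp_D) auto
  finally show ?thesis .
qed

lemma prob_increment:
  assumes "0 \<le> s" "s \<le> t" and [measurable]: "A \<in> sets borel"
  shows "prob {\<omega>\<in>space M. D t \<omega> - D s \<omega> \<in> A} = prob {\<omega>\<in>space M. D (t - s) \<omega> \<in> A}"
proof -
  have "measure (distr M borel (\<lambda>\<omega>. D t \<omega> - D s \<omega>)) A = measure (distr M borel (D (t - s))) A"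
    by (simp add: distr_increment assms)
  then show ?thesis by (simp add: measure_distr vimage_def Int_def conj_commute)
qed

lemma left_lim_D_measurable[measurable]: "(\<lambda>\<omega>. left_lim (\<lambda>t. D t \<omega>) a) \<in> borel_measurable M"
  by (rule measurable_left_lim[where M = M]) (auto intro: mono_on_D)

text \<open>The jump \<delta> at \<open>a\<close> is at most the increment over [a - h, a], so the
  expectation of exp(-\<delta>) is at least exp(-h \<psi>(1)) for every small h. Letting h tend to 0
  forces exp(-\<delta>) = 1 almost surely: a fixed time is not a jump time.\<close>

lemma AE_left_lim_eq:
  assumes "0 < a"
  shows "AE \<omega> in M. left_lim (\<lambda>t. D t \<omega>) a = D a \<omega>"
proof -
  define \<delta> where "\<delta> \<omega> = D a \<omega> - left_lim (\<lambda>t. D t \<omega>) a" for \<omega>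
  have [measurable]: "\<delta> \<in> borel_measurable M" unfolding \<delta>_def by measurable
  have \<delta>: "0 \<le> \<delta> \<omega>" if "\<omega> \<in> space M" for \<omega>
    using left_lim_le[OF mono_on_D[OF that] D_0[OF that], of a] assms by (simp add: \<delta>_def)
  have int: "integrable M (\<lambda>\<omega>. exp (- \<delta> \<omega>))"
    by (rule integrable_const_bound[where B=1]) (auto simp: \<delta>)
  have le: "exp (- (a / real (n + 2)) * \<psi> 1) \<le> expectation (\<lambda>\<omega>. exp (- \<delta> \<omega>))" for n
  proof -
    \<comment> \<open>Dividing by n + 2 keeps a - h strictly positive for every n, as
      \<open>le_left_lim\<close> demands.\<close>
    define h where "h = a / real (n + 2)"
    have "a * 1 < a * real (n + 2)" using assms by (intro mult_strict_left_mono) auto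
    then have h: "0 < h" "h < a" using assms by (auto simp: h_def divide_less_eq)
    have "exp (- (a - (a - h)) * \<psi> 1) = expectation (\<lambda>\<omega>. exp (- 1 * (D a \<omega> - D (a - h) \<omega>)))"
      using h by (intro expectation_exp_increment[symmetric]) auto
    also have "\<dots> \<le> expectation (\<lambda>\<omega>. exp (- \<delta> \<omega>))"
    proof (rule integral_mono)
      show "integrable M (\<lambda>\<omega>. exp (- 1 * (D a \<omega> - D (a - h) \<omega>)))"
        using h by (intro integrable_const_bound[where B=1]) (auto intro!: D_mono)
      show "exp (- 1 * (D a \<omega> - D (a - h) \<omega>)) \<le> exp (- \<delta> \<omega>)" if "\<omega> \<in> space M" for \<omega>
        using le_left_lim[OF mono_on_D[OF that], of "a - h" a] h by (simp add: \<delta>_def)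
    qed (rule int)
    finally show ?thesis by (simp add: h_def)
  qed
  have "(\<lambda>n. exp (- (a / real (n + 2)) * \<psi> 1)) \<longlonglongrightarrow> exp (- 0 * \<psi> 1)"
    using LIMSEQ_ignore_initial_segment[OF lim_const_over_n, of a 2]
    by (rule tendsto_exp[OF tendsto_mult_right[OF tendsto_minus]])
  then have ge: "1 \<le> expectation (\<lambda>\<omega>. exp (- \<delta> \<omega>))"
    using le by (intro LIMSEQ_le_const2[of _ 1]) auto
  have "expectation (\<lambda>\<omega>. 1 - exp (- \<delta> \<omega>)) = 1 - expectation (\<lambda>\<omega>. exp (- \<delta> \<omega>))"
    using int by (simp add: prob_space)
  also have "\<dots> \<le> 0" using ge by simp
  finally have "expectation (\<lambda>\<omega>. 1 - exp (- \<delta> \<omega>)) = 0"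
    using \<delta> by (intro antisym integral_nonneg_AE) auto
  then have "AE \<omega> in M. 1 - exp (- \<delta> \<omega>) = 0"
    by (subst (asm) integral_nonneg_eq_0_iff_AE) (use int \<delta> in auto)
  then show ?thesis by (rule AE_mp) (auto simp: \<delta>_def)
qed

text \<open>By the exponential Markov inequality, the probability that no D(m) exceeds B is at most
  exp(B - n \<psi>(1)) for every n, hence 0. This is what removes the default value
  \<open>Inf {}\<close> almost surely; integer levels and times keep everything countable.\<close>

lemma AE_D_unbounded: "AE \<omega> in M. \<forall>B::nat. \<exists>m::nat. B < D m \<omega>"
  unfolding AE_all_countable
proof
  fix B :: nat
  let ?S = "{\<omega>\<in>space M. \<forall>m::nat. D m \<omega> \<le> B}"
  have "prob ?S \<le> exp B * exp (- real n * \<psi> 1)" for n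
  proof -
    have "prob ?S = expectation (indicator ?S)" by simp
    also have "\<dots> \<le> expectation (\<lambda>\<omega>. exp B * exp (- 1 * D n \<omega>))"
    proof (rule integral_mono)
      show "integrable M (\<lambda>\<omega>. exp (real B) * exp (- 1 * D n \<omega>))"
        by (intro integrable_mult_right integrable_const_bound[where B=1]) (auto simp: D_nonneg)
      show "indicator ?S \<omega> \<le> exp (real B) * exp (- 1 * D n \<omega>)" if "\<omega> \<in> space M" for \<omega>
        by (auto simp: indicator_def exp_add[symmetric])
    qed (auto intro!: integrable_real_indicator simp: emeasure_eq_measure)
    also have "\<dots> = exp B * exp (- real n * \<psi> 1)"
      using expectation_exp_D[of 1 n] by simp
    finally show ?thesis .
  qed
  moreover have "(\<lambda>n. exp B * exp (- real n * \<psi> 1)) \<longlonglongrightarrow> exp B * 0"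
  proof (intro tendsto_intros)
    have "(\<lambda>n. exp (- \<psi> 1) ^ n) \<longlonglongrightarrow> 0" using psi_pos[of 1] by (intro LIMSEQ_realpow_zero) auto
    then show "(\<lambda>n. exp (- real n * \<psi> 1)) \<longlonglongrightarrow> 0" by (simp add: exp_of_nat_mult[symmetric])
  qed
  ultimately have "prob ?S \<le> exp B * 0" using LIMSEQ_le_const by blast
  then have "prob ?S = 0" by (simp add: measure_le_0_iff)
  then have "AE \<omega> in M. \<omega> \<notin> ?S" by (subst (asm) prob_eq_0) auto
  then show "AE \<omega> in M. \<exists>m::nat. B < D m \<omega>" by (rule AE_mp) (auto simp: not_le)
qed

end

section \<open>Left limits of the subordinator along deterministic times\<close>

context tempered_stable
begin

definition left_D :: "real \<Rightarrow> 'a \<Rightarrow> real" where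
  "left_D a \<omega> = left_lim (\<lambda>t. D t \<omega>) a"

text \<open>The law of D(a-) as a function of a, measurable in a so that a random duration can be
  inserted. For a > 0 it is also the law of D(a).\<close>

definition left_D_law :: "real set \<Rightarrow> real \<Rightarrow> ennreal" where
  "left_D_law A a = (\<integral>\<^sup>+\<omega>. indicator A (left_D a \<omega>) \<partial>M)"

text \<open>The sigma-algebra of \<open>K\<close> may be coarser than that of \<open>M\<close>:
  taking the one generated by the subordinator gives the measurability required by
  \<open>nn_integral_indep_diagonal\<close>.\<close>

lemma measurable_left_D:
  assumes "a \<in> borel_measurable N" "g \<in> N \<rightarrow>\<^sub>M K" "\<And>t. D t \<in> borel_measurable K" "space K = space M"
  shows "(\<lambda>x. left_D (a x) (g x)) \<in> borel_measurable N"
  unfolding left_D_def by (rule measurable_left_lim[OF assms(1-3)]) (auto simp: assms(4) mono_on_D)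

lemma measurable_left_D_M[measurable (raw)]:
  assumes "a \<in> borel_measurable N" "g \<in> N \<rightarrow>\<^sub>M M"
  shows "(\<lambda>x. left_D (a x) (g x)) \<in> borel_measurable N"
  by (rule measurable_left_D[OF assms]) auto

lemma left_D_law_measurable[measurable]: "A \<in> sets borel \<Longrightarrow> left_D_law A \<in> borel_measurable borel"
proof -
  have [measurable]: "(\<lambda>x. left_D (fst x) (snd x)) \<in> borel_measurable (borel \<Otimes>\<^sub>M M)"
    by (rule measurable_left_D_M) auto
  show "left_D_law A \<in> borel_measurable borel" if [measurable]: "A \<in> sets borel"
    unfolding left_D_law_def by measurable
qed

lemma left_D_law_eq_prob:
  assumes [measurable]: "A \<in> sets borel" and "0 < a"
  shows "left_D_law A a = prob {\<omega>\<in>space M. D a \<omega> \<in> A}"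
proof -
  have "left_D_law A a = (\<integral>\<^sup>+\<omega>. indicator {\<omega>\<in>space M. D a \<omega> \<in> A} \<omega> \<partial>M)"
    unfolding left_D_law_def using AE_left_lim_eq[OF \<open>0 < a\<close>]
    by (intro nn_integral_cong_AE) (auto elim!: AE_mp simp: left_D_def indicator_def)
  then show ?thesis by (simp add: emeasure_eq_measure)
qed

text \<open>The subordinator has independent consecutive increments along any finite sorted list.
  Listing s 0, s 0 + e 0, s 1, s 1 + e 1, ... puts the wanted intervals at even positions and the
  gaps between them at odd ones; stationarity then removes the starting points.\<close>

lemma prob_disjoint_increments:
  fixes s e :: "nat \<Rightarrow> real"
  assumes s0: "0 \<le> s 0" and e: "\<And>i. 0 \<le> e i" and s: "\<And>i. s i + e i \<le> s (Suc i)"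
    and J: "finite J" "J \<noteq> {}" and [measurable]: "\<And>j. A j \<in> sets borel"
  shows "prob {\<omega>\<in>space M. \<forall>j\<in>J. D (s j + e j) \<omega> - D (s j) \<omega> \<in> A j} =
    (\<Prod>j\<in>J. prob {\<omega>\<in>space M. D (e j) \<omega> \<in> A j})"
proof -
  obtain m where m: "J \<subseteq> {..<m}" using J(1) finite_nat_iff_bounded by blast
  define t where "t i = (if even i then s (i div 2) else s (i div 2) + e (i div 2))" for i
  \<comment> \<open>With 2m entries the increments are indexed by 0, ..., 2m - 2, which includes 2j
    for every j < m.\<close>
  define ts where "ts = map t [0..<2 * m]"
  have s_nonneg: "0 \<le> s i" for i
  proof (induction i)
    case (Suc i)
    then show ?case using e[of i] s[of i] by simp
  qed (rule s0)
  have "t i \<le> t (Suc i)" for i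
    using e[of "i div 2"] s[of "i div 2"] by (auto simp: t_def elim!: oddE evenE)
  then have "sorted ts"
    by (auto simp: ts_def sorted_iff_nth_mono intro: lift_Suc_mono_le[of t])
  moreover have "\<forall>t\<in>set ts. 0 \<le> t" using s_nonneg e by (auto simp: ts_def t_def)
  ultimately have "indep_vars (\<lambda>_. borel) (\<lambda>i \<omega>. D (ts ! Suc i) \<omega> - D (ts ! i) \<omega>) {..<length ts - 1}"
    using subordinator unfolding tempered_stable_subordinator_def by blast
  then have "prob (\<Inter>i\<in>(*) 2 ` J. (\<lambda>\<omega>. D (ts ! Suc i) \<omega> - D (ts ! i) \<omega>) -` A (i div 2) \<inter> space M) =
     (\<Prod>i\<in>(*) 2 ` J. prob ((\<lambda>\<omega>. D (ts ! Suc i) \<omega> - D (ts ! i) \<omega>) -` A (i div 2) \<inter> space M))"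
    using J m by (intro indep_varsD) (auto simp: ts_def)
  also have "\<dots> = (\<Prod>j\<in>J. prob ((\<lambda>\<omega>. D (ts ! Suc (2 * j)) \<omega> - D (ts ! (2 * j)) \<omega>) -` A j \<inter> space M))"
    by (subst prod.reindex) (auto simp: inj_on_def)
  also have "\<dots> = (\<Prod>j\<in>J. prob {\<omega>\<in>space M. D (e j) \<omega> \<in> A j})"
  proof (rule prod.cong[OF refl])
    fix j assume "j \<in> J"
    then have "j < m" using m by auto
    then have "ts ! Suc (2 * j) = s j + e j" "ts ! (2 * j) = s j"
      by (auto simp: ts_def t_def)
    then have "prob ((\<lambda>\<omega>. D (ts ! Suc (2 * j)) \<omega> - D (ts ! (2 * j)) \<omega>) -` A j \<inter> space M) =
       prob {\<omega>\<in>space M. D (s j + e j) \<omega> - D (s j) \<omega> \<in> A j}"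
      by (auto intro!: arg_cong[where f=prob])
    also have "\<dots> = prob {\<omega>\<in>space M. D (e j) \<omega> \<in> A j}"
      using prob_increment[of "s j" "s j + e j" "A j"] s_nonneg[of j] e[of j] by simp
    finally show "prob ((\<lambda>\<omega>. D (ts ! Suc (2 * j)) \<omega> - D (ts ! (2 * j)) \<omega>) -` A j \<inter> space M) =
       prob {\<omega>\<in>space M. D (e j) \<omega> \<in> A j}" .
  qed
  also have "(\<Inter>i\<in>(*) 2 ` J. (\<lambda>\<omega>. D (ts ! Suc i) \<omega> - D (ts ! i) \<omega>) -` A (i div 2) \<inter> space M) =
    {\<omega>\<in>space M. \<forall>j\<in>J. D (s j + e j) \<omega> - D (s j) \<omega> \<in> A j}"
  proof -
    have "ts ! Suc (2 * j) = s j + e j \<and> ts ! (2 * j) = s j" if "j \<in> J" for j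
      using that m by (auto simp: ts_def t_def)
    then show ?thesis using J(2) by auto
  qed
  finally show ?thesis .
qed

text \<open>Only countably many deterministic times occur, so a single null set covers all
  replacements of left limits by values of D.\<close>

lemma nn_integral_disjoint_increments:
  fixes s e :: "nat \<Rightarrow> real"
  assumes s0: "0 < s 0" and e: "\<And>i. 0 < e i" and s: "\<And>i. s i + e i \<le> s (Suc i)"
    and J: "finite J" "J \<noteq> {}" and [measurable]: "\<And>j. A j \<in> sets borel"
  shows "(\<integral>\<^sup>+\<omega>. (\<Prod>j\<in>J. indicator (A j) (left_D (s j + e j) \<omega> - left_D (s j) \<omega>)) \<partial>M) = (\<Prod>j\<in>J. left_D_law (A j) (e j))"
proof -
  have s_pos: "0 < s i" for i
  proof (induction i)
    case (Suc i)
    then show ?case using e[of i] s[of i] by simp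
  qed (rule s0)
  have "AE \<omega> in M. \<forall>j. left_D (s j + e j) \<omega> = D (s j + e j) \<omega> \<and> left_D (s j) \<omega> = D (s j) \<omega>"
    unfolding AE_all_countable left_D_def
    by (intro allI AE_conjI AE_left_lim_eq add_pos_pos s_pos e)
  then have "(\<integral>\<^sup>+\<omega>. (\<Prod>j\<in>J. indicator (A j) (left_D (s j + e j) \<omega> - left_D (s j) \<omega>)) \<partial>M) =
    (\<integral>\<^sup>+\<omega>. indicator {\<omega>\<in>space M. \<forall>j\<in>J. D (s j + e j) \<omega> - D (s j) \<omega> \<in> A j} \<omega> \<partial>M)"
    by (intro nn_integral_cong_AE) (auto elim!: AE_mp simp: indicator_def prod_zero_iff J intro!: prod.neutral)
  also have "\<dots> = prob {\<omega>\<in>space M. \<forall>j\<in>J. D (s j + e j) \<omega> - D (s j) \<omega> \<in> A j}"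
    using J by (simp add: emeasure_eq_measure)
  also have "\<dots> = (\<Prod>j\<in>J. left_D_law (A j) (e j))"
    using s0 e s J by (subst prob_disjoint_increments)
      (auto simp: less_imp_le prod_ennreal[symmetric] left_D_law_eq_prob)
  finally show ?thesis .
qed

lemma nn_integral_exp_increment:
  assumes "0 < s" "0 < e" "0 \<le> u"
  shows "(\<integral>\<^sup>+\<omega>. ennreal (exp (- u * (left_D (s + e) \<omega> - left_D s \<omega>))) \<partial>M) = ennreal (exp (- e * \<psi> u))"
proof -
  have "AE \<omega> in M. left_D (s + e) \<omega> = D (s + e) \<omega> \<and> left_D s \<omega> = D s \<omega>"
    unfolding left_D_def using assms by (intro AE_conjI AE_left_lim_eq add_pos_pos)
  then have "(\<integral>\<^sup>+\<omega>. ennreal (exp (- u * (left_D (s + e) \<omega> - left_D s \<omega>))) \<partial>M) =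
     (\<integral>\<^sup>+\<omega>. ennreal (exp (- u * (D (s + e) \<omega> - D s \<omega>))) \<partial>M)"
    by (rule nn_integral_cong_AE[OF AE_mp]) auto
  also have "\<dots> = ennreal (expectation (\<lambda>\<omega>. exp (- u * (D (s + e) \<omega> - D s \<omega>))))"
    using assms by (intro nn_integral_eq_integral integrable_const_bound[where B=1] AE_I2)
      (auto intro!: mult_nonneg_nonneg D_mono)
  also have "\<dots> = ennreal (exp (- e * \<psi> u))"
    using expectation_exp_increment[of u s "s + e"] assms by simp
  finally show ?thesis .
qed

end

section \<open>Inter-phase times\<close>

definition queue_events :: "'a measure \<Rightarrow> (nat \<Rightarrow> 'a \<Rightarrow> real) \<Rightarrow> (nat \<Rightarrow> 'a \<Rightarrow> real) \<Rightarrow> 'a set set" where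
  "queue_events M X E = (\<Union>n. {X n -` A \<inter> space M | A. A \<in> sets borel}
                                   \<union> {E n -` A \<inter> space M | A. A \<in> sets borel})"

definition subordinator_events :: "'a measure \<Rightarrow> (real \<Rightarrow> 'a \<Rightarrow> real) \<Rightarrow> 'a set set" where
  "subordinator_events M D = (\<Union>t. {D t -` A \<inter> space M | A. A \<in> sets borel})"

text \<open>\<open>N\<close> stays free because it is used both for \<open>M\<close> and for the
  sigma-algebra generated by the queue.\<close>

lemma phase_start_measurable:
  assumes [measurable]: "\<And>n. X n \<in> borel_measurable N" "\<And>n. E n \<in> borel_measurable N"
  shows "(\<lambda>\<omega>. phase_start k (arrival_times X \<omega>) (\<lambda>i. E i \<omega>) n) \<in> borel_measurable N"
proof (induction n)
  case 0
  then show ?case by (simp add: arrival_times_def)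
next
  case (Suc n)
  note [measurable] = Suc
  have [measurable]: "(\<lambda>\<omega>. arrival_times X \<omega> m) \<in> borel_measurable N" for m
    unfolding arrival_times_def by measurable
  show ?case by simp
qed

text \<open>Waiting for the next arrival can only create idle gaps; this non-overlap of phases is
  what lets independent increments apply.\<close>

lemma phase_start_Suc_ge: "phase_start k T E n + E n \<le> phase_start k T E (Suc n)"
  by simp

section \<open>Inter-phase times: independence, common law and Laplace transform\<close>

locale tempered_erlang = tempered_stable M \<theta> \<alpha> D
  for M :: "'a measure" and \<theta> \<alpha> :: real and D :: "real \<Rightarrow> 'a \<Rightarrow> real" +
  fixes k :: nat and lam \<beta> :: real and X E :: "nat \<Rightarrow> 'a \<Rightarrow> real"
  assumes lam_pos: "0 < lam" and beta_pos: "0 < \<beta>"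
    and distributed_X: "\<And>n. distributed M lborel (X n) (exponential_density lam)"
    and distributed_E: "\<And>n. distributed M lborel (E n) (exponential_density \<beta>)"
    and indep_E: "indep_vars (\<lambda>_. borel) E UNIV"
    and indep_queue: "indep_set (sigma_sets (space M) (queue_events M X E))
      (sigma_sets (space M) (subordinator_events M D))"
begin

abbreviation P :: "nat \<Rightarrow> 'a \<Rightarrow> real" where
  "P \<equiv> inter_phase_time k X E D"

definition \<sigma> :: "nat \<Rightarrow> 'a \<Rightarrow> real" where
  "\<sigma> n \<omega> = phase_start k (arrival_times X \<omega>) (\<lambda>i. E i \<omega>) n"

text \<open>The outcome is doubled: the first component determines the queue and the second the
  subordinator path, so that the queue can be frozen while the path is integrated. The diagonal
  recovers the actual model.\<close>

definition increment :: "nat \<Rightarrow> 'a \<times> 'a \<Rightarrow> real" where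
  "increment n z = left_D (\<sigma> n (fst z) + E n (fst z)) (snd z) - left_D (\<sigma> n (fst z)) (snd z)"

lemma X_measurable[measurable]: "X n \<in> borel_measurable M"
  using distributed_measurable[OF distributed_X] by simp

lemma E_measurable[measurable]: "E n \<in> borel_measurable M"
  using distributed_measurable[OF distributed_E] by simp

lemma sigma_measurable[measurable]: "\<sigma> n \<in> borel_measurable M"
  unfolding \<sigma>_def by (rule phase_start_measurable) auto

text \<open>The formula covers exceptional paths as well: \<open>M\<close> need not be complete, so
  measurability of \<open>P n\<close> could not be inferred from an almost sure identity.\<close>

lemma P_eq:
  assumes "\<omega> \<in> space M"
  shows "P n \<omega> = (if 0 < E n \<omega> \<and> ((\<forall>B::nat. \<exists>m::nat. B < D m \<omega>) \<or> Inf {} \<notin> {\<sigma> n \<omega>..<\<sigma> n \<omega> + E n \<omega>})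
    then increment n (\<omega>, \<omega>) else 0)"
  unfolding inter_phase_time_def Let_def \<sigma>_def[symmetric]
    measure_inv_sub_interval[where D=D and \<omega>=\<omega>, OF mono_on_D[OF assms]]
  by (auto simp: increment_def left_D_def)

lemma P_measurable[measurable]: "P n \<in> borel_measurable M"
proof -
  have "(\<lambda>\<omega>. if 0 < E n \<omega> \<and> ((\<forall>B::nat. \<exists>m::nat. B < D m \<omega>) \<or> Inf {} \<notin> {\<sigma> n \<omega>..<\<sigma> n \<omega> + E n \<omega>})
    then increment n (\<omega>, \<omega>) else 0) \<in> borel_measurable M"
    unfolding increment_def fst_conv snd_conv atLeastLessThan_iff by measurable
  then show ?thesis by (subst measurable_cong[OF P_eq]) auto
qed

lemma AE_pos: "AE \<omega> in M. \<forall>n. 0 < X n \<omega> \<and> 0 < E n \<omega>"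
proof -
  have "prob {\<omega>\<in>space M. 0 < X n \<omega>} = 1" "prob {\<omega>\<in>space M. 0 < E n \<omega>} = 1" for n
    using exponential_distributedD_gt[OF distributed_X _ lam_pos, of 0 n]
      exponential_distributedD_gt[OF distributed_E _ beta_pos, of 0 n] by auto
  then have "AE \<omega> in M. 0 < X n \<omega>" "AE \<omega> in M. 0 < E n \<omega>" for n
    by (auto simp: prob_Collect_eq_1)
  then show ?thesis unfolding AE_all_countable by (intro allI AE_conjI)
qed

lemma AE_P_eq: "AE \<omega> in M. \<forall>n. P n \<omega> = increment n (\<omega>, \<omega>)"
  using AE_pos AE_D_unbounded AE_space by eventually_elim (auto simp: P_eq)

lemma increment_measurable:
  "increment n \<in> borel_measurable (sigma (space M) (queue_events M X E) \<Otimes>\<^sub>M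
      sigma (space M) (subordinator_events M D))"
proof -
  define A where "A = sigma (space M) (queue_events M X E)"
  define B where "B = sigma (space M) (subordinator_events M D)"
  have sub: "queue_events M X E \<subseteq> Pow (space M)" "subordinator_events M D \<subseteq> Pow (space M)"
    by (auto simp: queue_events_def subordinator_events_def)
  have "X n \<in> borel_measurable A" "E n \<in> borel_measurable A" for n
    using sub unfolding A_def measurable_def
    by (auto simp: queue_events_def intro!: sigma_sets.Basic)
  then have [measurable]: "\<sigma> n \<in> borel_measurable A" "E n \<in> borel_measurable A" for n
    unfolding \<sigma>_def by (auto intro!: phase_start_measurable)
  have D: "D t \<in> borel_measurable B" for t
    using sub unfolding B_def measurable_def
    by (auto simp: subordinator_events_def intro!: sigma_sets.Basic)
  have "space B = space M" using sub by (simp add: B_def space_measure_of)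
  \<comment> \<open>Stated for any measurable time \<open>a\<close>, since both the start and the
    end of the phase are inserted.\<close>
  then have [measurable]: "(\<lambda>z. left_D (a z) (snd z)) \<in> borel_measurable (A \<Otimes>\<^sub>M B)"
    if "a \<in> borel_measurable (A \<Otimes>\<^sub>M B)" for a
    by (intro measurable_left_D[OF that measurable_snd D])
  show ?thesis unfolding increment_def[abs_def] A_def[symmetric] B_def[symmetric] by measurable
qed

text \<open>The functional \<open>f\<close> of a subfamily is kept general so that joint
  probabilities and the Laplace transform are both instances.\<close>

lemma nn_integral_P:
  assumes [measurable]: "f \<in> borel_measurable (PiM J (\<lambda>_. borel))"
  shows "(\<integral>\<^sup>+\<omega>. f (\<lambda>j\<in>J. P j \<omega>) \<partial>M) = (\<integral>\<^sup>+x. \<integral>\<^sup>+y. f (\<lambda>j\<in>J. increment j (x, y)) \<partial>M \<partial>M)"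
proof -
  note [measurable] = increment_measurable
  have "(\<integral>\<^sup>+\<omega>. f (\<lambda>j\<in>J. P j \<omega>) \<partial>M) = (\<integral>\<^sup>+\<omega>. f (\<lambda>j\<in>J. increment j (\<omega>, \<omega>)) \<partial>M)"
    using AE_P_eq by (intro nn_integral_cong_AE) auto
  also have "\<dots> = (\<integral>\<^sup>+x. \<integral>\<^sup>+y. f (\<lambda>j\<in>J. increment j (x, y)) \<partial>M \<partial>M)"
    by (rule nn_integral_indep_diagonal[OF indep_queue]) measurable
  finally show ?thesis .
qed

lemma sigma_pos:
  assumes "\<forall>n. 0 < X n \<omega> \<and> 0 < E n \<omega>"
  shows "0 < \<sigma> n \<omega>"
proof (induction n)
  case 0
  then show ?case using assms by (simp add: \<sigma>_def arrival_times_def)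
next
  case (Suc n)
  then show ?case using phase_start_Suc_ge[of k "arrival_times X \<omega>" "\<lambda>i. E i \<omega>" n] assms
    unfolding \<sigma>_def by (meson add_pos_pos less_le_trans)
qed

text \<open>With the queue frozen at x, the inner integral is the product of the
  \<open>left_D_law (A j) (E j x)\<close>: starts and idle gaps have disappeared. Only independent
  durations with a common law remain, so the outer integral factorises and \<open>E 0\<close> may
  stand for every \<open>E j\<close>.\<close>

lemma prob_P:
  assumes J: "finite J" "J \<noteq> {}" and [measurable]: "\<And>j. A j \<in> sets borel"
  shows "ennreal (prob {\<omega>\<in>space M. \<forall>j\<in>J. P j \<omega> \<in> A j}) = (\<Prod>j\<in>J. \<integral>\<^sup>+\<omega>. left_D_law (A j) (E 0 \<omega>) \<partial>M)"
proof -
  have "ennreal (prob {\<omega>\<in>space M. \<forall>j\<in>J. P j \<omega> \<in> A j}) =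
    (\<integral>\<^sup>+\<omega>. indicator {\<omega>\<in>space M. \<forall>j\<in>J. P j \<omega> \<in> A j} \<omega> \<partial>M)"
    using J by (simp add: emeasure_eq_measure)
  also have "\<dots> = (\<integral>\<^sup>+\<omega>. (\<Prod>j\<in>J. indicator (A j) ((\<lambda>j\<in>J. P j \<omega>) j)) \<partial>M)"
    by (intro nn_integral_cong) (auto simp: indicator_def prod_zero_iff J intro!: prod.neutral[symmetric])
  also have "\<dots> = (\<integral>\<^sup>+x. \<integral>\<^sup>+y. (\<Prod>j\<in>J. indicator (A j) ((\<lambda>j\<in>J. increment j (x, y)) j)) \<partial>M \<partial>M)"
    by (rule nn_integral_P) measurable
  also have "\<dots> = (\<integral>\<^sup>+x. (\<Prod>j\<in>J. left_D_law (A j) (E j x)) \<partial>M)"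
  proof (rule nn_integral_cong_AE)
    show "AE x in M. (\<integral>\<^sup>+y. (\<Prod>j\<in>J. indicator (A j) ((\<lambda>j\<in>J. increment j (x, y)) j)) \<partial>M) = (\<Prod>j\<in>J. left_D_law (A j) (E j x))"
      using AE_pos
    proof eventually_elim
      case (elim x)
      have "(\<integral>\<^sup>+\<omega>. (\<Prod>j\<in>J. indicator (A j) (left_D (\<sigma> j x + E j x) \<omega> - left_D (\<sigma> j x) \<omega>)) \<partial>M) =
          (\<Prod>j\<in>J. left_D_law (A j) (E j x))"
        using elim sigma_pos[OF elim]
        by (intro nn_integral_disjoint_increments J) (auto simp: \<sigma>_def intro: phase_start_Suc_ge simp del: phase_start.simps)
      then show ?case by (simp add: increment_def)
    qed
  qed
  also have "\<dots> = (\<Prod>j\<in>J. \<integral>\<^sup>+x. left_D_law (A j) (E j x) \<partial>M)"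
    using J(1)
    by (intro indep_vars_nn_integral indep_vars_compose2[where Y = "\<lambda>j. left_D_law (A j)" and X = E and M' = "\<lambda>_. borel"]
        indep_vars_subset[OF indep_E]) auto
  also have "\<dots> = (\<Prod>j\<in>J. \<integral>\<^sup>+\<omega>. left_D_law (A j) (E 0 \<omega>) \<partial>M)"
  proof (rule prod.cong[OF refl])
    fix j
    have "(\<integral>\<^sup>+x. left_D_law (A j) (E i x) \<partial>M) = (\<integral>\<^sup>+x. left_D_law (A j) x \<partial>density lborel (exponential_density \<beta>))" for i
      unfolding distributed_distr_eq_density[OF distributed_E, symmetric, of i]
      by (subst nn_integral_distr) auto
    then show "(\<integral>\<^sup>+x. left_D_law (A j) (E j x) \<partial>M) = (\<integral>\<^sup>+\<omega>. left_D_law (A j) (E 0 \<omega>) \<partial>M)" by simp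
  qed
  finally show ?thesis .
qed

lemma prob_P_single:
  assumes [measurable]: "A \<in> sets borel"
  shows "ennreal (prob {\<omega>\<in>space M. P n \<omega> \<in> A}) = (\<integral>\<^sup>+\<omega>. left_D_law A (E 0 \<omega>) \<partial>M)"
  using prob_P[of "{n}" "\<lambda>_. A"] by simp

lemma indep_P: "indep_vars (\<lambda>_. borel) P UNIV"
  unfolding indep_vars_def2
proof (intro conjI ballI indep_setsI)
  fix A :: "nat \<Rightarrow> 'a set" and J :: "nat set"
  assume J: "J \<noteq> {}" "finite J" and "\<forall>j\<in>J. A j \<in> {P j -` B \<inter> space M |B. B \<in> sets borel}"
  then have "\<forall>j\<in>J. \<exists>B. B \<in> sets borel \<and> A j = P j -` B \<inter> space M" by blast
  then obtain B where B: "\<And>j. j \<in> J \<Longrightarrow> B j \<in> sets borel \<and> A j = P j -` B j \<inter> space M"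
    by metis
  \<comment> \<open>\<open>prob_P\<close> asks for measurable sets at every index, not only in
    \<open>J\<close>; the empty set fills the rest.\<close>
  define B' where "B' j = (if j \<in> J then B j else {})" for j
  have [measurable]: "B' j \<in> sets borel" for j using B by (auto simp: B'_def)
  have A: "A j = {\<omega>\<in>space M. P j \<omega> \<in> B' j}" if "j \<in> J" for j
    using B[OF that] that by (auto simp: B'_def)
  have "ennreal (prob {\<omega>\<in>space M. \<forall>j\<in>J. P j \<omega> \<in> B' j}) = (\<Prod>j\<in>J. ennreal (prob {\<omega>\<in>space M. P j \<omega> \<in> B' j}))"
    by (simp add: prob_P J prob_P_single)
  then have "prob {\<omega>\<in>space M. \<forall>j\<in>J. P j \<omega> \<in> B' j} = (\<Prod>j\<in>J. prob {\<omega>\<in>space M. P j \<omega> \<in> B' j})"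
    by (simp add: prod_ennreal prod_nonneg)
  moreover have "(\<Inter>j\<in>J. A j) = {\<omega>\<in>space M. \<forall>j\<in>J. P j \<omega> \<in> B' j}" using A J(1) by auto
  ultimately show "prob (\<Inter>j\<in>J. A j) = (\<Prod>j\<in>J. prob (A j))" by (simp add: A)
qed (auto simp: P_measurable)

text \<open>The right-hand side of \<open>prob_P_single\<close> does not mention n.\<close>

lemma distr_P: "distr M borel (P n) = distr M borel (P 0)"
proof (rule measure_eqI)
  fix A assume "A \<in> sets (distr M borel (P n))"
  then have [measurable]: "A \<in> sets borel" by simp
  have "ennreal (prob {\<omega>\<in>space M. P n \<omega> \<in> A}) = ennreal (prob {\<omega>\<in>space M. P 0 \<omega> \<in> A})"
    by (simp only: prob_P_single \<open>A \<in> sets borel\<close>)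
  then have "prob {\<omega>\<in>space M. P n \<omega> \<in> A} = prob {\<omega>\<in>space M. P 0 \<omega> \<in> A}"
    by (subst (asm) ennreal_inj) auto
  then show "emeasure (distr M borel (P n)) A = emeasure (distr M borel (P 0)) A"
    by (simp add: emeasure_distr emeasure_eq_measure vimage_def Int_def conj_commute)
qed simp

lemma expectation_exp_P:
  assumes u: "0 < u"
  shows "expectation (\<lambda>\<omega>. exp (- u * P n \<omega>)) = \<beta> / (\<beta> + \<psi> u)"
proof -
  have \<psi>: "0 < \<psi> u" by (rule psi_pos[OF u])
  have nonneg: "0 \<le> P n \<omega>" if "\<omega> \<in> space M" for \<omega>
    unfolding inter_phase_time_def Let_def by simp
  have "ennreal (expectation (\<lambda>\<omega>. exp (- u * P n \<omega>))) = (\<integral>\<^sup>+\<omega>. ennreal (exp (- u * P n \<omega>)) \<partial>M)"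
    using nonneg u by (intro nn_integral_eq_integral[symmetric] integrable_const_bound[where B=1]) auto
  also have "\<dots> = (\<integral>\<^sup>+\<omega>. ennreal (exp (- u * (\<lambda>j\<in>{n}. P j \<omega>) n)) \<partial>M)" by simp
  also have "\<dots> = (\<integral>\<^sup>+x. \<integral>\<^sup>+y. ennreal (exp (- u * (\<lambda>j\<in>{n}. increment j (x, y)) n)) \<partial>M \<partial>M)"
    by (rule nn_integral_P) measurable
  also have "\<dots> = (\<integral>\<^sup>+x. ennreal (exp (- E n x * \<psi> u)) \<partial>M)"
  proof (rule nn_integral_cong_AE)
    show "AE x in M. (\<integral>\<^sup>+y. ennreal (exp (- u * (\<lambda>j\<in>{n}. increment j (x, y)) n)) \<partial>M) = ennreal (exp (- E n x * \<psi> u))"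
      using AE_pos
    proof eventually_elim
      case (elim x)
      then show ?case using nn_integral_exp_increment[of "\<sigma> n x" "E n x" u] sigma_pos[OF elim, of n] u
        by (simp add: increment_def)
    qed
  qed
  also have "\<dots> = (\<integral>\<^sup>+x. ennreal (exp (- x * \<psi> u)) \<partial>density lborel (exponential_density \<beta>))"
    unfolding distributed_distr_eq_density[OF distributed_E, symmetric, of n]
    by (subst nn_integral_distr) auto
  \<comment> \<open>The density of rate \<beta> times exp(-x \<psi>(u)) is a constant times the
    density of rate \<beta> + \<psi>(u), whose mass is 1, so no integral has to be
    evaluated.\<close>
  also have "\<dots> = (\<integral>\<^sup>+x. ennreal (\<beta> / (\<beta> + \<psi> u)) * ennreal (exponential_density (\<beta> + \<psi> u) x) \<partial>lborel)"
  proof (subst nn_integral_density)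
    show "(\<integral>\<^sup>+x. ennreal (exponential_density \<beta> x) * ennreal (exp (- x * \<psi> u)) \<partial>lborel) =
      (\<integral>\<^sup>+x. ennreal (\<beta> / (\<beta> + \<psi> u)) * ennreal (exponential_density (\<beta> + \<psi> u) x) \<partial>lborel)"
    proof (rule nn_integral_cong)
      fix x
      have "exponential_density \<beta> x * exp (- x * \<psi> u) = \<beta> / (\<beta> + \<psi> u) * exponential_density (\<beta> + \<psi> u) x"
      proof -
        have "exp (- x * \<beta>) * exp (- x * \<psi> u) = exp (- x * (\<beta> + \<psi> u))"
          by (simp add: exp_add[symmetric] algebra_simps)
        then show ?thesis using \<psi> beta_pos by (simp add: exponential_density_def)
      qed
      moreover have "0 \<le> \<beta> / (\<beta> + \<psi> u)" "0 \<le> exponential_density (\<beta> + \<psi> u) x" "0 \<le> exponential_density \<beta> x"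
        using \<psi> beta_pos by (auto simp: exponential_density_def)
      ultimately show "ennreal (exponential_density \<beta> x) * ennreal (exp (- x * \<psi> u)) =
          ennreal (\<beta> / (\<beta> + \<psi> u)) * ennreal (exponential_density (\<beta> + \<psi> u) x)"
        by (metis ennreal_mult exp_ge_zero)
    qed
  qed auto
  also have "\<dots> = ennreal (\<beta> / (\<beta> + \<psi> u)) * emeasure (density lborel (exponential_density (\<beta> + \<psi> u))) UNIV"
    by (simp add: nn_integral_cmult emeasure_density)
  also have "\<dots> = ennreal (\<beta> / (\<beta> + \<psi> u))"
    using prob_space.emeasure_space_1[OF prob_space_exponential_density, of "\<beta> + \<psi> u"] \<psi> beta_pos by simp
  finally show ?thesis using \<psi> beta_pos by (subst (asm) ennreal_inj) auto
qed

end

section \<open>Uniqueness of Laplace transforms\<close>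

text \<open>Every polynomial in exp(-t) integrates to 0 against g, and Stone-Weierstrass
  approximates \<phi> uniformly on [0,1]. The vanishing of g at negative t keeps exp(-t) inside
  [0,1] wherever it matters.\<close>

lemma integral_comp_exp_eq_0:
  fixes g \<phi> :: "real \<Rightarrow> real"
  assumes g[measurable]: "integrable lborel g" and supp: "\<And>t. t < 0 \<Longrightarrow> g t = 0"
    and moments: "\<And>n::nat. (\<integral>t. exp (- t) ^ n * g t \<partial>lborel) = 0"
    and cont: "continuous_on UNIV \<phi>"
  shows "(\<integral>t. \<phi> (exp (- t)) * g t \<partial>lborel) = 0"
proof -
  have [measurable]: "\<phi> \<in> borel_measurable borel"
    using cont by (rule borel_measurable_continuous_onI)
  have bound_int: "integrable lborel (\<lambda>t. f (exp (- t)) * g t)"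
    if [measurable]: "f \<in> borel_measurable borel" and B: "\<And>x. x \<in> {0..1} \<Longrightarrow> \<bar>f x\<bar> \<le> B" for f :: "real \<Rightarrow> real" and B
  proof (rule Bochner_Integration.integrable_bound)
    show "integrable lborel (\<lambda>t. B * g t)" using g by simp
    show "AE t in lborel. norm (f (exp (- t)) * g t) \<le> norm (B * g t)"
    proof (rule AE_I2)
      fix t show "norm (f (exp (- t)) * g t) \<le> norm (B * g t)"
      proof (cases "t < 0")
        case False
        then have "\<bar>f (exp (- t))\<bar> \<le> \<bar>B\<bar>" using B[of "exp (- t)"] by simp
        then show ?thesis by (simp add: abs_mult mult_right_mono)
      qed (simp add: supp)
    qed
  qed simp
  have "\<bar>\<integral>t. \<phi> (exp (- t)) * g t \<partial>lborel\<bar> \<le> e * (\<integral>t. \<bar>g t\<bar> \<partial>lborel)" if e: "0 < e" for e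
  proof -
    obtain p where p: "real_polynomial_function p" "\<And>x. x \<in> {0..1} \<Longrightarrow> \<bar>\<phi> x - p x\<bar> < e"
      by (rule Stone_Weierstrass_real_polynomial_function[OF compact_Icc continuous_on_subset[OF cont subset_UNIV] e]) blast
    obtain a n where p_eq: "p = (\<lambda>x. \<Sum>i\<le>n. a i * x ^ i)"
      using p(1) unfolding real_polynomial_function_iff_sum by blast
    have [measurable]: "p \<in> borel_measurable borel" unfolding p_eq by measurable
    have pow: "integrable lborel (\<lambda>t. exp (- t) ^ i * g t)" for i
      by (rule bound_int[of "\<lambda>x. x ^ i" 1]) (auto simp: power_le_one)
    have diff: "integrable lborel (\<lambda>t. (\<phi> (exp (- t)) - p (exp (- t))) * g t)"
      by (rule bound_int[of "\<lambda>x. \<phi> x - p x" e]) (auto intro!: less_imp_le p)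
    have p_eq': "p (exp (- t)) * g t = (\<Sum>i\<le>n. a i * (exp (- t) ^ i * g t))" for t
      by (simp add: p_eq sum_distrib_right mult.assoc)
    have p0: "(\<integral>t. p (exp (- t)) * g t \<partial>lborel) = 0" and pint: "integrable lborel (\<lambda>t. p (exp (- t)) * g t)"
      unfolding p_eq' using pow moments by (simp_all add: integral_sum)
    have "\<phi> (exp (- t)) * g t = (\<phi> (exp (- t)) - p (exp (- t))) * g t + p (exp (- t)) * g t" for t
      by (simp add: algebra_simps)
    then have "(\<integral>t. \<phi> (exp (- t)) * g t \<partial>lborel) = (\<integral>t. (\<phi> (exp (- t)) - p (exp (- t))) * g t \<partial>lborel)"
      using diff pint p0 by simp
    also have "\<bar>\<dots>\<bar> \<le> (\<integral>t. \<bar>(\<phi> (exp (- t)) - p (exp (- t))) * g t\<bar> \<partial>lborel)"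
      using integral_norm_bound[of lborel "\<lambda>t. (\<phi> (exp (- t)) - p (exp (- t))) * g t"] by simp
    also have "\<dots> \<le> (\<integral>t. e * \<bar>g t\<bar> \<partial>lborel)"
    proof (rule integral_mono)
      fix t
      show "\<bar>(\<phi> (exp (- t)) - p (exp (- t))) * g t\<bar> \<le> e * \<bar>g t\<bar>"
        using supp[of t] p(2)[of "exp (- t)"]
        by (cases "t < 0") (auto simp: abs_mult intro!: mult_right_mono)
    qed (use diff g in auto)
    finally show ?thesis by simp
  qed
  note bound = this
  have "\<bar>\<integral>t. \<phi> (exp (- t)) * g t \<partial>lborel\<bar> \<le> 0 + e" if "0 < e" for e
  proof -
    let ?I = "\<integral>t. \<bar>g t\<bar> \<partial>lborel"
    \<comment> \<open>Adding 1 avoids division by zero when g vanishes almost everywhere.\<close>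
    have I: "0 < ?I + 1" by (intro add_nonneg_pos) auto
    have "e * ?I \<le> e * (?I + 1)" using that by simp
    then have "e / (?I + 1) * ?I \<le> e" using I by (simp add: pos_divide_le_eq)
    moreover note bound[OF divide_pos_pos[OF that I]]
    ultimately show ?thesis by simp
  qed
  then show ?thesis using field_le_epsilon[of "\<bar>\<integral>t. \<phi> (exp (- t)) * g t \<partial>lborel\<bar>" 0] by simp
qed

text \<open>The condition t < b is exp(-t) > exp(-b), and the indicator of that half-line is a
  pointwise limit of continuous functions with values in [0,1].\<close>

lemma integral_lessThan_eq_0:
  fixes g :: "real \<Rightarrow> real"
  assumes g: "integrable lborel g" and supp: "\<And>t. t < 0 \<Longrightarrow> g t = 0"
    and moments: "\<And>n::nat. (\<integral>t. exp (- t) ^ n * g t \<partial>lborel) = 0"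
  shows "(\<integral>t. indicator {..<b} t * g t \<partial>lborel) = 0"
proof -
  define c where "c = exp (- b)"
  \<comment> \<open>For m > 0 this ramp is 0 up to c and 1 from c + 1/m on; being 0 at c itself, it
    matches the strict inequality.\<close>
  define \<phi> where "\<phi> m x = min 1 (max 0 (real m * (x - c)))" for m x
  have [measurable]: "g \<in> borel_measurable lborel" using g by auto
  have cont: "continuous_on UNIV (\<phi> m)" for m unfolding \<phi>_def by (intro continuous_intros)
  have [measurable]: "\<phi> m \<in> borel_measurable borel" for m
    using cont by (rule borel_measurable_continuous_onI)
  have lim: "(\<lambda>m. \<phi> m x) \<longlonglongrightarrow> indicator {c<..} x" for x
  proof (cases "c < x")
    case True
    then obtain N :: nat where N: "1 / (x - c) < N" using reals_Archimedean2 by blast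
    have "\<phi> m x = 1" if "N \<le> m" for m
    proof -
      have "1 / (x - c) < m" using N that by simp
      then show ?thesis using True by (simp add: \<phi>_def field_simps)
    qed
    then show ?thesis using True by (intro tendsto_eventually eventually_sequentiallyI[of N]) auto
  next
    case False
    then have "\<phi> m x = 0" for m by (simp add: \<phi>_def mult_nonneg_nonpos)
    then show ?thesis using False by simp
  qed
  have "(\<lambda>m. \<integral>t. \<phi> m (exp (- t)) * g t \<partial>lborel) \<longlonglongrightarrow> (\<integral>t. indicator {c<..} (exp (- t)) * g t \<partial>lborel)"
  proof (rule integral_dominated_convergence[where w = "\<lambda>t. \<bar>g t\<bar>"])
    show "AE t in lborel. norm (\<phi> m (exp (- t)) * g t) \<le> \<bar>g t\<bar>" for m
      by (auto simp: abs_mult \<phi>_def intro!: mult_left_le_one_le)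
    show "AE t in lborel. (\<lambda>m. \<phi> m (exp (- t)) * g t) \<longlonglongrightarrow> indicator {c<..} (exp (- t)) * g t"
      by (intro AE_I2 tendsto_mult_right lim)
  qed (use g in auto)
  moreover have "(\<integral>t. \<phi> m (exp (- t)) * g t \<partial>lborel) = 0" for m
    by (rule integral_comp_exp_eq_0[OF g supp moments cont])
  moreover have "indicator {c<..} (exp (- t)) = (indicator {..<b} t :: real)" for t
    by (auto simp: indicator_def c_def)
  ultimately show ?thesis by (simp add: LIMSEQ_const_iff)
qed

text \<open>If g(t) > 0, right-continuity gives g > g(t)/2 on some [t, b), and the integral there, a
  difference of two vanishing half-line integrals, would be positive.\<close>

lemma right_continuous_not_pos:
  fixes g :: "real \<Rightarrow> real"
  assumes g: "integrable lborel g" and zero: "\<And>b. (\<integral>t. indicator {..<b} t * g t \<partial>lborel) = 0"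
    and cont: "continuous (at_right t) g"
  shows "\<not> 0 < g t"
proof
  assume pos: "0 < g t"
  have "eventually (\<lambda>x. g t / 2 < g x) (at_right t)"
    using cont pos unfolding continuous_within by (intro order_tendstoD(1)) auto
  then obtain b where b: "t < b" "\<And>x. t < x \<Longrightarrow> x < b \<Longrightarrow> g t / 2 < g x"
    unfolding eventually_at_right_field by auto
  have int: "integrable lborel (\<lambda>x. indicator {..<c} x * g x)" for c
    using integrable_mult_indicator[OF _ g, of "{..<c}"] by simp
  have "g t / 2 * (b - t) = (\<integral>x. indicator {t..<b} x * (g t / 2) \<partial>lborel)" using b by simp
  also have "\<dots> \<le> (\<integral>x. indicator {..<b} x * g x - indicator {..<t} x * g x \<partial>lborel)"
  proof (rule integral_mono)
    show "integrable lborel (\<lambda>x. indicator {t..<b} x * (g t / 2))"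
      using b by (intro integrable_mult_left integrable_real_indicator) auto
    show "indicator {t..<b} x * (g t / 2) \<le> indicator {..<b} x * g x - indicator {..<t} x * g x" for x
      using b(1) b(2)[of x] pos by (cases "x = t") (auto simp: indicator_def)
  qed (intro Bochner_Integration.integrable_diff int)
  also have "\<dots> = 0" using int zero by simp
  finally show False using pos b by (simp add: mult_le_0_iff)
qed

text \<open>\<open>right_continuous_not_pos\<close> is applied to g and to -g. The result is a
  uniqueness theorem of Lerch type: only integer exponents enter, and right-continuity gives
  vanishing at the point t itself instead of almost everywhere.\<close>

lemma right_continuous_eq_0:
  fixes g :: "real \<Rightarrow> real"
  assumes g: "integrable lborel g" and supp: "\<And>t. t < 0 \<Longrightarrow> g t = 0"
    and moments: "\<And>n::nat. (\<integral>t. exp (- t) ^ n * g t \<partial>lborel) = 0"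
    and cont: "continuous (at_right t) g"
  shows "g t = 0"
proof -
  have zero: "(\<integral>t. indicator {..<b} t * g t \<partial>lborel) = 0" for b
    by (rule integral_lessThan_eq_0[OF g supp moments])
  have "\<not> 0 < g t" by (rule right_continuous_not_pos[OF g zero cont])
  moreover have "\<not> 0 < - g t"
    using zero by (intro right_continuous_not_pos[of "\<lambda>t. - g t"]) (use g cont in \<open>auto intro: continuous_minus\<close>)
  ultimately show ?thesis by simp
qed

text \<open>Tonelli for the indicator of 0 <= t < P: for a fixed outcome, exp(-s t) integrates over
  [0, P) to (1 - exp(-s P)) / s.\<close>

lemma (in prob_space) has_bochner_integral_exp_tail:
  fixes P :: "'a \<Rightarrow> real"
  assumes [measurable]: "P \<in> borel_measurable M" and nonneg: "\<And>\<omega>. \<omega> \<in> space M \<Longrightarrow> 0 \<le> P \<omega>" and s: "0 < s"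
  shows "has_bochner_integral lborel
    (\<lambda>t. indicator {0..} t * (exp (- s * t) * prob {\<omega>\<in>space M. t < P \<omega>}))
    ((1 - expectation (\<lambda>\<omega>. exp (- s * P \<omega>))) / s)"
proof (rule has_bochner_integral_nn_integral)
  have int: "integrable M (\<lambda>\<omega>. exp (- s * P \<omega>))"
    using nonneg s by (intro integrable_const_bound[where B=1]) auto
  have "expectation (\<lambda>\<omega>. exp (- s * P \<omega>)) \<le> expectation (\<lambda>\<omega>. 1)"
    using nonneg s by (intro integral_mono int) auto
  then show "0 \<le> (1 - expectation (\<lambda>\<omega>. exp (- s * P \<omega>))) / s" using s by (simp add: prob_space)
  interpret pair_sigma_finite lborel M by unfold_locales
  have eq: "ennreal (prob {\<omega>\<in>space M. t < P \<omega>}) = (\<integral>\<^sup>+\<omega>. indicator {\<omega>\<in>space M. t < P \<omega>} \<omega> \<partial>M)" for t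
    by (simp add: emeasure_eq_measure)
  \<comment> \<open>The tail is measurable in t as a partial integral of a jointly measurable
    indicator.\<close>
  have [measurable]: "(\<lambda>t. prob {\<omega>\<in>space M. t < P \<omega>}) \<in> borel_measurable lborel"
  proof -
    have "(\<lambda>t. enn2real (\<integral>\<^sup>+\<omega>. indicator {\<omega>\<in>space M. t < P \<omega>} \<omega> \<partial>M)) \<in> borel_measurable lborel"
      by measurable
    then show ?thesis unfolding eq[symmetric] by simp
  qed
  show "(\<lambda>t. indicator {0..} t * (exp (- s * t) * prob {\<omega>\<in>space M. t < P \<omega>})) \<in> borel_measurable lborel"
    by measurable
  have "(\<integral>\<^sup>+t. ennreal (indicator {0..} t * (exp (- s * t) * prob {\<omega>\<in>space M. t < P \<omega>})) \<partial>lborel) =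
    (\<integral>\<^sup>+t. \<integral>\<^sup>+\<omega>. ennreal (exp (- s * t)) * indicator {0..<P \<omega>} t \<partial>M \<partial>lborel)"
  proof (rule nn_integral_cong)
    fix t :: real
    have "ennreal (indicator {0..} t * (exp (- s * t) * prob {\<omega>\<in>space M. t < P \<omega>})) =
       ennreal (exp (- s * t)) * (indicator {0..} t * ennreal (prob {\<omega>\<in>space M. t < P \<omega>}))"
      by (auto simp: ennreal_mult indicator_def)
    also have "\<dots> = (\<integral>\<^sup>+\<omega>. ennreal (exp (- s * t)) * (indicator {0..} t * indicator {\<omega>\<in>space M. t < P \<omega>} \<omega>) \<partial>M)"
      unfolding eq by (cases "0 \<le> t") (simp_all add: nn_integral_cmult)
    also have "\<dots> = (\<integral>\<^sup>+\<omega>. ennreal (exp (- s * t)) * indicator {0..<P \<omega>} t \<partial>M)"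
      by (intro nn_integral_cong) (auto simp: indicator_def)
    finally show "ennreal (indicator {0..} t * (exp (- s * t) * prob {\<omega>\<in>space M. t < P \<omega>})) =
      (\<integral>\<^sup>+\<omega>. ennreal (exp (- s * t)) * indicator {0..<P \<omega>} t \<partial>M)" .
  qed
  also have "\<dots> = (\<integral>\<^sup>+\<omega>. \<integral>\<^sup>+t. ennreal (exp (- s * t)) * indicator {0..<P \<omega>} t \<partial>lborel \<partial>M)"
    unfolding atLeastLessThan_iff indicator_def by (rule Fubini'[symmetric]) measurable
  also have "\<dots> = (\<integral>\<^sup>+\<omega>. ennreal ((1 - exp (- s * P \<omega>)) / s) \<partial>M)"
  proof (rule nn_integral_cong)
    fix \<omega> assume \<omega>: "\<omega> \<in> space M"
    have "AE t in lborel. t \<noteq> P \<omega>" by (rule AE_lborel_singleton)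
    then have "(\<integral>\<^sup>+t. ennreal (exp (- s * t)) * indicator {0..<P \<omega>} t \<partial>lborel) =
        (\<integral>\<^sup>+t. ennreal (exp (- s * t)) * indicator {0..P \<omega>} t \<partial>lborel)"
      by (rule nn_integral_cong_AE[OF AE_mp]) (auto simp: indicator_def)
    also have "\<dots> = ennreal (- exp (- s * P \<omega>) / s - (- exp (- s * 0) / s))"
      using s nonneg[OF \<omega>]
      by (intro nn_integral_FTC_Icc) (auto intro!: derivative_eq_intros simp: has_real_derivative_iff_has_vector_derivative[symmetric])
    finally show "(\<integral>\<^sup>+t. ennreal (exp (- s * t)) * indicator {0..<P \<omega>} t \<partial>lborel) =
       ennreal ((1 - exp (- s * P \<omega>)) / s)" by (simp add: diff_divide_distrib)
  qed
  also have "\<dots> = ennreal (expectation (\<lambda>\<omega>. (1 - exp (- s * P \<omega>)) / s))"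
    using int nonneg s by (intro nn_integral_eq_integral) auto
  also have "expectation (\<lambda>\<omega>. (1 - exp (- s * P \<omega>)) / s) = (1 - expectation (\<lambda>\<omega>. exp (- s * P \<omega>))) / s"
    using int by (simp add: prob_space)
  finally show "(\<integral>\<^sup>+t. ennreal (indicator {0..} t * (exp (- s * t) * prob {\<omega>\<in>space M. t < P \<omega>})) \<partial>lborel) =
    ennreal ((1 - expectation (\<lambda>\<omega>. exp (- s * P \<omega>))) / s)" .
qed (auto simp: indicator_def)

lemma (in prob_space) right_continuous_tail:
  fixes P :: "'a \<Rightarrow> real"
  assumes [measurable]: "P \<in> borel_measurable M"
  shows "continuous (at_right t) (\<lambda>t. prob {\<omega>\<in>space M. t < P \<omega>})"
proof -
  interpret P: real_distribution "distr M borel P" by simp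
  have "prob {\<omega>\<in>space M. t < P \<omega>} = 1 - cdf (distr M borel P) t" for t
  proof -
    have "cdf (distr M borel P) t = prob {\<omega>\<in>space M. P \<omega> \<le> t}"
      by (simp add: cdf_def measure_distr vimage_def Int_def conj_commute)
    then show ?thesis using prob_neg[of "\<lambda>\<omega>. P \<omega> \<le> t"] by (simp add: not_le)
  qed
  then show ?thesis using P.cdf_is_right_cont[of t] by (simp add: continuous_diff)
qed

section \<open>The Mittag-Leffler series\<close>

text \<open>Unordered sums suit a triple index. An enumeration of the index type reduces the claim
  to \<open>integrable_suminf\<close>; infinitude makes that enumeration a bijection with
  \<open>nat\<close>.\<close>

lemma has_bochner_integral_infsum:
  fixes f :: "'i::countable \<Rightarrow> 'a \<Rightarrow> real"
  assumes inf: "infinite (UNIV :: 'i set)"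
    and f: "\<And>i. has_bochner_integral M (f i) (I i)"
    and abs: "\<And>x. x \<in> space M \<Longrightarrow> (\<lambda>i. \<bar>f i x\<bar>) summable_on UNIV"
    and abs_int: "(\<lambda>i. \<integral>x. \<bar>f i x\<bar> \<partial>M) summable_on UNIV"
  shows "has_bochner_integral M (\<lambda>x. \<Sum>\<^sub>\<infinity>i. f i x) (\<Sum>\<^sub>\<infinity>i. I i)"
proof -
  define e :: "nat \<Rightarrow> 'i" where "e = from_nat_into UNIV"
  have e: "bij_betw e UNIV UNIV"
    unfolding e_def using bij_betw_from_nat_into[of "UNIV :: 'i set"] inf by auto
  have sums: "(\<lambda>n. g (e n)) sums (\<Sum>\<^sub>\<infinity>i. g i)" if "g summable_on UNIV" for g :: "'i \<Rightarrow> real"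
  proof -
    have "(g has_sum (\<Sum>\<^sub>\<infinity>i. g i)) UNIV" using that by simp
    then have "((\<lambda>n. g (e n)) has_sum (\<Sum>\<^sub>\<infinity>i. g i)) UNIV"
      using has_sum_reindex_bij_betw[OF e] by blast
    then show ?thesis by (rule has_sum_imp_sums)
  qed
  have int: "integrable M (f i)" and I: "I i = integral\<^sup>L M (f i)" for i
    using f[of i] by (auto simp: has_bochner_integral_iff)
  have "(\<lambda>i. norm (I i)) summable_on UNIV"
    by (rule summable_on_comparison_test[OF abs_int])
       (use integral_norm_bound[of M "f _"] in \<open>auto simp: I\<close>)
  then have I_sum: "I summable_on UNIV" by (rule abs_summable_summable)
  have ae: "AE x in M. summable (\<lambda>n. norm (f (e n) x))"
    using sums[OF abs] by (intro AE_I2) (auto simp: sums_iff)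
  have si: "summable (\<lambda>n. \<integral>x. norm (f (e n) x) \<partial>M)"
    using sums[OF abs_int] by (simp add: sums_iff)
  have eq: "(\<Sum>\<^sub>\<infinity>i. f i x) = (\<Sum>n. f (e n) x)" if "x \<in> space M" for x
    using sums[OF abs_summable_summable, of "\<lambda>i. f i x"] abs[OF that] by (simp add: sums_iff)
  have "integrable M (\<lambda>x. \<Sum>n. f (e n) x)"
    by (rule integrable_suminf[OF int ae si])
  moreover have "(\<integral>x. (\<Sum>n. f (e n) x) \<partial>M) = (\<Sum>\<^sub>\<infinity>i. I i)"
    using integral_suminf[OF int ae si] sums[OF I_sum] by (simp add: I sums_iff)
  ultimately have "has_bochner_integral M (\<lambda>x. \<Sum>n. f (e n) x) (\<Sum>\<^sub>\<infinity>i. I i)"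
    by (simp add: has_bochner_integral_iff)
  then show ?thesis by (subst has_bochner_integral_cong[OF refl eq refl]) auto
qed

lemma has_bochner_integral_powr_exp:
  fixes p w :: real
  assumes "0 \<le> p" "0 < w"
  shows "has_bochner_integral lborel (\<lambda>t. indicator {0..} t * (t powr p * exp (- w * t)))
    (Gamma (p + 1) / w powr (p + 1))"
proof (rule has_bochner_integral_nn_integral)
  have G: "0 < Gamma (p + 1)" using assms by (intro Gamma_real_pos) auto
  then show "0 \<le> Gamma (p + 1) / w powr (p + 1)" by simp
  have "ennreal (Gamma (p + 1)) = (\<integral>\<^sup>+t. ennreal (indicator {0..} t * t powr p / exp t) \<partial>lborel)"
    using Gamma_conv_nn_integral_real[of "p + 1"] assms by simp
  \<comment> \<open>Euler's integral for Gamma(p + 1) with w t substituted for t.\<close>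
  also have "\<dots> = ennreal w * (\<integral>\<^sup>+t. ennreal (indicator {0..} (w * t) * (w * t) powr p / exp (w * t)) \<partial>lborel)"
    using assms by (subst nn_integral_real_affine[where c = w and t = 0]) auto
  also have "\<dots> = ennreal w * (\<integral>\<^sup>+t. ennreal (w powr p) * ennreal (indicator {0..} t * (t powr p * exp (- w * t))) \<partial>lborel)"
  proof -
    have "indicator {0..} (w * t) * (w * t) powr p / exp (w * t) =
        w powr p * (indicator {0..} t * (t powr p * exp (- w * t)))" for t :: real
      using assms
      by (cases "0 \<le> t") (simp_all add: powr_mult exp_minus divide_inverse zero_le_mult_iff mult.assoc)
    then have "ennreal (indicator {0..} (w * t) * (w * t) powr p / exp (w * t)) =
        ennreal (w powr p) * ennreal (indicator {0..} t * (t powr p * exp (- w * t)))" for t :: real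
      by (simp add: ennreal_mult')
    then show ?thesis by (simp only:)
  qed
  also have "\<dots> = ennreal w * ennreal (w powr p) * (\<integral>\<^sup>+t. ennreal (indicator {0..} t * (t powr p * exp (- w * t))) \<partial>lborel)"
    by (subst nn_integral_cmult) (auto simp: mult.assoc)
  also have "ennreal w * ennreal (w powr p) = ennreal (w powr (p + 1))"
    using assms by (simp add: ennreal_mult[symmetric] powr_add mult.commute)
  finally have eq: "ennreal (Gamma (p + 1)) =
     ennreal (w powr (p + 1)) * (\<integral>\<^sup>+t. ennreal (indicator {0..} t * (t powr p * exp (- w * t))) \<partial>lborel)" .
  have "ennreal (Gamma (p + 1) / w powr (p + 1)) = ennreal (Gamma (p + 1)) / ennreal (w powr (p + 1))"
    using assms G by (intro divide_ennreal[symmetric]) auto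
  then show "(\<integral>\<^sup>+t. ennreal (indicator {0..} t * (t powr p * exp (- w * t))) \<partial>lborel) = ennreal (Gamma (p + 1) / w powr (p + 1))"
    unfolding eq using assms by (subst (asm) mult.commute) (simp add: ennreal_mult_divide_eq)
qed (auto simp: indicator_def)

text \<open>Bounding the terms of the series by those of its Laplace transform makes pointwise absolute
  convergence and local uniformity follow from the convergence of the transform.\<close>

lemma powr_div_Gamma_le:
  fixes p w t v :: real
  assumes "0 \<le> p" "0 < w" "0 \<le> t" and v: "\<And>x. t < x \<Longrightarrow> v \<le> x powr p"
  shows "v / Gamma (p + 1) \<le> exp (w * (t + 1)) / w powr (p + 1)"
proof -
  have G: "0 < Gamma (p + 1)" using assms by (intro Gamma_real_pos) auto
  note b = has_bochner_integral_powr_exp[OF assms(1,2)]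
  \<comment> \<open>Only the part of the transform over (t, t + 1] is kept, where x powr p >= v and
    exp(-w x) >= exp(-w (t + 1)). The number v stands for the power at t and also allows the value 1
    at t = 0, p = 0.\<close>
  have "v * exp (- w * (t + 1)) = (\<integral>x. indicator {t<..t+1} x * (v * exp (- w * (t + 1))) \<partial>lborel)"
    by simp
  also have "\<dots> \<le> (\<integral>x. indicator {0..} x * (x powr p * exp (- w * x)) \<partial>lborel)"
  proof (rule integral_mono)
    show "integrable lborel (\<lambda>x. indicator {t<..t+1} x * (v * exp (- w * (t + 1))))"
      by (intro integrable_mult_left integrable_real_indicator) auto
    show "integrable lborel (\<lambda>x. indicator {0..} x * (x powr p * exp (- w * x)))"
      using b by (simp add: has_bochner_integral_iff)
    show "indicator {t<..t+1} x * (v * exp (- w * (t + 1))) \<le> indicator {0..} x * (x powr p * exp (- w * x))" for x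
    proof (cases "x \<in> {t<..t+1}")
      case True
      have "v * exp (- w * (t + 1)) \<le> x powr p * exp (- w * (t + 1))"
        using v True by (intro mult_right_mono) auto
      also have "\<dots> \<le> x powr p * exp (- w * x)"
        using True assms by (intro mult_left_mono) auto
      finally show ?thesis using True assms by simp
    qed (auto simp: indicator_def)
  qed
  also have "\<dots> = Gamma (p + 1) / w powr (p + 1)"
    using b by (simp add: has_bochner_integral_iff)
  finally have "v * exp (- w * (t + 1)) * exp (w * (t + 1)) \<le> Gamma (p + 1) / w powr (p + 1) * exp (w * (t + 1))"
    by (rule mult_right_mono) simp
  then have "v \<le> Gamma (p + 1) / w powr (p + 1) * exp (w * (t + 1))"
    by (simp add: mult.assoc exp_add[symmetric])
  then show ?thesis using G by (simp add: field_simps)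
qed

lemma pochhammer_nonneg_real:
  fixes a :: real
  shows "0 \<le> a \<Longrightarrow> 0 \<le> pochhammer a n"
  by (cases "a = 0") (auto simp: pochhammer_0_left pochhammer_nonneg)

text \<open>Newton's binomial series with exponent -a, using that (-a choose n) is (-1)^n times the
  Pochhammer symbol over n!. The case a = 0 is the term r = 0 of the series.\<close>

lemma has_sum_negative_binomial:
  fixes a x :: real
  assumes "0 \<le> a" "0 \<le> x" "x < 1"
  shows "((\<lambda>j. pochhammer a j / fact j * x ^ j) has_sum (1 - x) powr (- a)) UNIV"
proof (rule sums_nonneg_imp_has_sum)
  have "(- a gchoose n) * (- x) ^ n = pochhammer a n / fact n * x ^ n" for n
    by (simp add: gbinomial_pochhammer power_mult_distrib[symmetric])
  then show "(\<lambda>j. pochhammer a j / fact j * x ^ j) sums (1 - x) powr (- a)"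
    using gen_binomial_real[of "- x" "- a"] assms by simp
qed (use assms in \<open>auto intro!: mult_nonneg_nonneg divide_nonneg_nonneg pochhammer_nonneg_real\<close>)

lemma has_sum_geometric:
  fixes z :: real
  assumes "\<bar>z\<bar> < 1"
  shows "((\<lambda>n. z ^ n) has_sum 1 / (1 - z)) UNIV"
  using assms by (intro norm_summable_imp_has_sum geometric_sums) (auto simp: power_abs summable_geometric)

lemma summable_on_pairs:
  fixes f :: "'a \<times> 'b \<Rightarrow> real"
  assumes "f summable_on UNIV"
  shows "(\<lambda>y. f (x, y)) summable_on UNIV" "(\<lambda>x. \<Sum>\<^sub>\<infinity>y. f (x, y)) summable_on UNIV"
    and "(\<Sum>\<^sub>\<infinity>z. f z) = (\<Sum>\<^sub>\<infinity>x. \<Sum>\<^sub>\<infinity>y. f (x, y))"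
  using summable_on_SigmaD1[of "\<lambda>x y. f (x, y)" UNIV "\<lambda>_. UNIV" x]
    summable_on_Sigma_banach[of "\<lambda>x y. f (x, y)" UNIV "\<lambda>_. UNIV"]
    infsum_Sigma_banach[of f UNIV "\<lambda>_. UNIV"] assms by simp_all

section \<open>The triple series over q, r, j and its Laplace transform at w\<close>

context
  fixes \<theta> \<alpha> w :: real
  assumes theta: "0 < \<theta>" and alpha: "0 < \<alpha>" and w: "\<theta> < w"
begin

text \<open>With W = w^\<alpha> and x = \<theta>^\<alpha>/W, the sum over j contributes (1 -
  x)^(-r), which leaves a geometric series in r of ratio b/(W - \<theta>^\<alpha>). The same
  computation at |b| gives the absolute convergence that licenses iterated summation.\<close>

lemma has_sum_binomial_geometric:
  assumes b: "\<bar>b\<bar> < w powr \<alpha> - \<theta> powr \<alpha>"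
  defines "f \<equiv> \<lambda>b (r :: nat, j :: nat). (b / w powr \<alpha>) ^ r * (pochhammer (real r) j / fact j * (\<theta> powr \<alpha> / w powr \<alpha>) ^ j)"
  shows "(f b has_sum 1 / (1 - b / (w powr \<alpha> - \<theta> powr \<alpha>))) UNIV" "f \<bar>b\<bar> summable_on UNIV"
proof -
  define W where "W = w powr \<alpha>"
  define x where "x = \<theta> powr \<alpha> / W"
  have W: "0 < W" using theta w by (simp add: W_def)
  have "\<theta> powr \<alpha> < W" unfolding W_def using theta w alpha by (intro powr_less_mono2) auto
  then have x: "0 \<le> x" "x < 1" using W by (auto simp: x_def)
  have \<psi>: "w powr \<alpha> - \<theta> powr \<alpha> = W * (1 - x)" using W by (simp add: x_def W_def field_simps)
  have inner: "((\<lambda>j. f c (r, j)) has_sum (c / (W * (1 - x))) ^ r) UNIV" for c r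
  proof -
    have "((\<lambda>j. (c / W) ^ r * (pochhammer (real r) j / fact j * x ^ j)) has_sum (c / W) ^ r * (1 - x) powr (- real r)) UNIV"
      using x by (intro has_sum_cmult_right has_sum_negative_binomial) auto
    moreover have "(c / W) ^ r * (1 - x) powr (- real r) = (c / (W * (1 - x))) ^ r"
      using x by (simp add: powr_minus powr_realpow power_divide power_mult_distrib divide_inverse power_inverse)
    ultimately show ?thesis by (simp add: f_def W_def x_def)
  qed
  have outer: "((\<lambda>r. (c / (W * (1 - x))) ^ r) has_sum 1 / (1 - c / (W * (1 - x)))) UNIV" if "\<bar>c\<bar> = \<bar>b\<bar>" for c
    using b W x that unfolding \<psi> by (intro has_sum_geometric) (auto simp: abs_mult)
  have nonneg: "0 \<le> f \<bar>b\<bar> (r, j)" for r j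
    using W x by (auto simp: f_def intro!: mult_nonneg_nonneg divide_nonneg_nonneg pochhammer_nonneg_real)
  have "f \<bar>b\<bar> summable_on Sigma UNIV (\<lambda>_. UNIV)"
    by (rule summable_on_SigmaI[OF inner]) (use outer[of "\<bar>b\<bar>"] nonneg in \<open>auto simp: has_sum_imp_summable\<close>)
  then show abs: "f \<bar>b\<bar> summable_on UNIV" by simp
  have norm_eq: "norm (f b z) = f \<bar>b\<bar> z" for z
  proof -
    obtain r j where z: "z = (r, j)" by (cases z)
    define Y where "Y = pochhammer (real r) j / fact j * (\<theta> powr \<alpha> / w powr \<alpha>) ^ j"
    have "0 \<le> Y"
      unfolding Y_def by (intro mult_nonneg_nonneg divide_nonneg_nonneg pochhammer_nonneg_real) auto
    then show ?thesis unfolding z f_def prod.case Y_def[symmetric] by (simp add: abs_mult power_abs)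
  qed
  have "f b summable_on UNIV" by (rule abs_summable_summable) (unfold norm_eq, rule abs)
  then have "(f b has_sum 1 / (1 - b / (W * (1 - x)))) (Sigma UNIV (\<lambda>_. UNIV))"
    by (intro has_sum_SigmaI[OF inner outer]) auto
  then show "(f b has_sum 1 / (1 - b / (w powr \<alpha> - \<theta> powr \<alpha>))) UNIV" by (simp add: \<psi>)
qed

text \<open>The Gamma factor is left out: it divides the terms of the series and cancels in their
  Laplace transforms, so one coefficient serves both.\<close>

definition series_coeff :: "real \<Rightarrow> nat \<times> nat \<times> nat \<Rightarrow> real" where
  "series_coeff b = (\<lambda>(q, r, j). \<theta> ^ q * b ^ r * (pochhammer (real r) j * (\<theta> powr \<alpha>) ^ j / fact j))"

definition series_exponent :: "nat \<times> nat \<times> nat \<Rightarrow> real" where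
  "series_exponent = (\<lambda>(q, r, j). real q + real (r + j) * \<alpha>)"

text \<open>The power \<open>t powr series_exponent i\<close> is split up, because \<open>0 powr 0 = 0\<close> would give the wrong value at
  \<open>t = 0\<close> for the leading term.\<close>

definition series_power :: "nat \<times> nat \<times> nat \<Rightarrow> real \<Rightarrow> real" where
  "series_power = (\<lambda>(q, r, j) t. t ^ q * (t powr \<alpha>) ^ (r + j))"

lemma series_exponent_nonneg: "0 \<le> series_exponent i"
  using alpha by (auto simp: series_exponent_def split: prod.split)

lemma abs_series_coeff: "\<bar>series_coeff b i\<bar> = series_coeff \<bar>b\<bar> i"
  using theta by (auto simp: series_coeff_def abs_mult power_abs pochhammer_nonneg_real split: prod.split)

lemma series_power_eq: "0 < t \<Longrightarrow> series_power i t = t powr series_exponent i"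
proof -
  assume t: "0 < t"
  have "(t powr \<alpha>) ^ n = t powr (real n * \<alpha>)" for n
    using t by (simp add: powr_realpow[symmetric] powr_powr mult.commute)
  then show ?thesis
    using t by (simp add: series_power_def series_exponent_def powr_add powr_realpow split: prod.split)
qed

lemma series_power_nonneg: "0 \<le> t \<Longrightarrow> 0 \<le> series_power i t"
  by (auto simp: series_power_def split: prod.split)

lemma series_power_le:
  assumes "0 \<le> t" "t < x"
  shows "series_power i t \<le> x powr series_exponent i"
proof -
  have "series_power i t \<le> series_power i x"
    using assms alpha by (auto simp: series_power_def intro!: mult_mono power_mono powr_mono2 split: prod.split)
  then show ?thesis using series_power_eq[of x i] assms by simp
qed

lemma continuous_on_series_power: "continuous_on {0..} (series_power i)"
  unfolding series_power_def using alpha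
  by (auto intro!: continuous_intros continuous_on_powr' split: prod.split)

lemma has_sum_series:
  assumes b: "\<bar>b\<bar> < w powr \<alpha> - \<theta> powr \<alpha>"
  shows "((\<lambda>i. series_coeff b i / w powr (series_exponent i + 1)) has_sum
      1 / (w - \<theta>) * (1 / (1 - b / (w powr \<alpha> - \<theta> powr \<alpha>)))) UNIV" (is "(?B b has_sum _) _")
    and "(\<lambda>i. series_coeff \<bar>b\<bar> i / w powr (series_exponent i + 1)) summable_on UNIV"
proof -
  define f where "f = (\<lambda>b (r :: nat, j :: nat). (b / w powr \<alpha>) ^ r * (pochhammer (real r) j / fact j * (\<theta> powr \<alpha> / w powr \<alpha>) ^ j))"
  have w0: "0 < w" using theta w by simp
  \<comment> \<open>The dependence on q splits off as a geometric factor, with sum 1/(w - \<theta>)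
    = 1/s for w = s + \<theta>.\<close>
  have B: "?B c (q, z) = 1 / w * (\<theta> / w) ^ q * f c z" for c q z
  proof -
    obtain r j where z: "z = (r, j)" by (cases z)
    have "w powr (series_exponent (q, z) + 1) = w * w ^ q * (w powr \<alpha>) ^ r * (w powr \<alpha>) ^ j"
      using w0 by (simp add: z series_exponent_def powr_add powr_realpow powr_powr[symmetric] ring_distribs mult.commute[of _ \<alpha>] mult_ac)
    then show ?thesis by (simp add: z f_def series_coeff_def power_divide mult_ac)
  qed
  have geo: "((\<lambda>q. 1 / w * (\<theta> / w) ^ q * S) has_sum 1 / w * (1 / (1 - \<theta> / w)) * S) UNIV" for S
    using theta w by (intro has_sum_cmult_left has_sum_cmult_right has_sum_geometric) auto
  have nonneg: "0 \<le> ?B \<bar>b\<bar> z" for z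
    unfolding abs_series_coeff[symmetric] by simp
  obtain S where S: "(f \<bar>b\<bar> has_sum S) UNIV"
    using has_sum_binomial_geometric(2)[OF b] unfolding f_def summable_on_def by blast
  have "?B \<bar>b\<bar> summable_on Sigma UNIV (\<lambda>_. UNIV)"
  proof (rule summable_on_SigmaI)
    show "((\<lambda>z. ?B \<bar>b\<bar> (q, z)) has_sum 1 / w * (\<theta> / w) ^ q * S) UNIV" for q
      unfolding B by (intro has_sum_cmult_right S)
    show "(\<lambda>q. 1 / w * (\<theta> / w) ^ q * S) summable_on UNIV"
      using geo has_sum_imp_summable by blast
  qed (rule nonneg)
  then show abs: "?B \<bar>b\<bar> summable_on UNIV" by simp
  have norm_eq: "norm (?B b z) = ?B \<bar>b\<bar> z" for z
    by (simp add: abs_series_coeff)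
  have "?B b summable_on UNIV" by (rule abs_summable_summable) (unfold norm_eq, rule abs)
  then have "(?B b has_sum 1 / w * (1 / (1 - \<theta> / w)) * (1 / (1 - b / (w powr \<alpha> - \<theta> powr \<alpha>)))) (Sigma UNIV (\<lambda>_. UNIV))"
  proof (intro has_sum_SigmaI)
    show "((\<lambda>z. ?B b (q, z)) has_sum 1 / w * (\<theta> / w) ^ q * (1 / (1 - b / (w powr \<alpha> - \<theta> powr \<alpha>)))) UNIV" for q
      unfolding B f_def by (intro has_sum_cmult_right has_sum_binomial_geometric(1)[OF b])
  qed (rule geo, simp)
  moreover have "1 / w * (1 / (1 - \<theta> / w)) = 1 / (w - \<theta>)" using w0 w by (simp add: field_simps)
  ultimately show "(?B b has_sum 1 / (w - \<theta>) * (1 / (1 - b / (w powr \<alpha> - \<theta> powr \<alpha>)))) UNIV" by simp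
qed

definition series_term :: "real \<Rightarrow> nat \<times> nat \<times> nat \<Rightarrow> real \<Rightarrow> real" where
  "series_term b i t = series_coeff b i / Gamma (series_exponent i + 1) * series_power i t"

text \<open>The bound depends on t only through a factor common to all indices, so pointwise
  absolute convergence and the Weierstrass test on bounded intervals both reduce to summability of
  the transforms at |b|.\<close>

lemma abs_series_term_le:
  assumes "0 \<le> t"
  shows "\<bar>series_term b i t\<bar> \<le> exp (w * (t + 1)) * (series_coeff \<bar>b\<bar> i / w powr (series_exponent i + 1))"
proof -
  have G: "0 < Gamma (series_exponent i + 1)"
    using series_exponent_nonneg[of i] by (intro Gamma_real_pos) auto
  have "\<bar>series_term b i t\<bar> = \<bar>series_coeff b i\<bar> * (series_power i t / Gamma (series_exponent i + 1))"
    using G series_power_nonneg[OF assms, of i] by (simp add: series_term_def abs_mult)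
  also have "\<dots> \<le> \<bar>series_coeff b i\<bar> * (exp (w * (t + 1)) / w powr (series_exponent i + 1))"
    using theta w assms
    by (intro mult_left_mono powr_div_Gamma_le series_exponent_nonneg series_power_le) auto
  finally show ?thesis by (simp add: abs_series_coeff mult_ac)
qed

lemma abs_summable_series_term:
  assumes b: "\<bar>b\<bar> < w powr \<alpha> - \<theta> powr \<alpha>" and t: "0 \<le> t"
  shows "(\<lambda>i. \<bar>series_term b i t\<bar>) summable_on UNIV"
  by (rule summable_on_comparison_test[OF summable_on_cmult_right[OF has_sum_series(2)[OF b]]])
     (use abs_series_term_le[OF t] in auto)

lemma continuous_on_series:
  assumes b: "\<bar>b\<bar> < w powr \<alpha> - \<theta> powr \<alpha>"
  shows "continuous_on {0..c} (\<lambda>t. \<Sum>\<^sub>\<infinity>i. series_term b i t)"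
proof (rule uniform_limit_theorem)
  show "uniform_limit {0..c} (\<lambda>X t. \<Sum>i\<in>X. series_term b i t) (\<lambda>t. \<Sum>\<^sub>\<infinity>i. series_term b i t) (finite_subsets_at_top UNIV)"
  proof (rule Weierstrass_m_test_general)
    fix i t assume t: "t \<in> {0..c}"
    have "\<bar>series_term b i t\<bar> \<le> exp (w * (t + 1)) * (series_coeff \<bar>b\<bar> i / w powr (series_exponent i + 1))"
      using t by (intro abs_series_term_le) auto
    also have "\<dots> \<le> exp (w * (c + 1)) * (series_coeff \<bar>b\<bar> i / w powr (series_exponent i + 1))"
      using t theta w unfolding abs_series_coeff[symmetric] by (intro mult_right_mono) auto
    finally show "norm (series_term b i t) \<le> exp (w * (c + 1)) * (series_coeff \<bar>b\<bar> i / w powr (series_exponent i + 1))"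
      by simp
  qed (rule summable_on_cmult_right[OF has_sum_series(2)[OF b]])
  show "\<forall>\<^sub>F X in finite_subsets_at_top UNIV. continuous_on {0..c} (\<lambda>t. \<Sum>i\<in>X. series_term b i t)"
    unfolding series_term_def
    by (intro always_eventually allI continuous_intros continuous_on_subset[OF continuous_on_series_power]) auto
qed simp

lemma has_bochner_integral_series_term:
  "has_bochner_integral lborel (\<lambda>t. indicator {0..} t * (exp (- w * t) * series_term b i t))
     (series_coeff b i / w powr (series_exponent i + 1))"
proof -
  define p where "p = series_exponent i"
  have G: "0 < Gamma (p + 1)"
    using series_exponent_nonneg[of i] by (intro Gamma_real_pos) (auto simp: p_def)
  have "has_bochner_integral lborel (\<lambda>t. series_coeff b i / Gamma (p + 1) * (indicator {0..} t * (t powr p * exp (- w * t))))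
    (series_coeff b i / Gamma (p + 1) * (Gamma (p + 1) / w powr (p + 1)))"
    using theta w by (intro has_bochner_integral_mult_right has_bochner_integral_powr_exp)
      (auto simp: p_def series_exponent_nonneg)
  \<comment> \<open>The two powers can differ at t = 0, where \<open>powr\<close> gives 0 even for
    exponent 0; this is a null set.\<close>
  moreover have eq: "series_coeff b i / Gamma (p + 1) * (indicator {0..} t * (t powr p * exp (- w * t))) =
      indicator {0..} t * (exp (- w * t) * series_term b i t)" if "t \<noteq> 0" for t
    using that series_power_eq[of t i] by (auto simp: series_term_def p_def indicator_def)
  have "AE t in lborel. series_coeff b i / Gamma (p + 1) * (indicator {0..} t * (t powr p * exp (- w * t))) =
      indicator {0..} t * (exp (- w * t) * series_term b i t)"
    using AE_lborel_singleton[of 0] by eventually_elim (rule eq)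
  moreover have "(\<lambda>t. indicator {0..} t * (exp (- w * t) * series_term b i t)) \<in> borel_measurable lborel"
    by (auto simp: series_term_def series_power_def split: prod.split)
  ultimately show ?thesis using G
    by (subst has_bochner_integral_cong_AE[where g = "\<lambda>t. series_coeff b i / Gamma (p + 1) * (indicator {0..} t * (t powr p * exp (- w * t)))"])
       (auto simp: p_def)
qed

lemma has_bochner_integral_series:
  assumes b: "\<bar>b\<bar> < w powr \<alpha> - \<theta> powr \<alpha>"
  shows "has_bochner_integral lborel (\<lambda>t. indicator {0..} t * (exp (- w * t) * (\<Sum>\<^sub>\<infinity>i. series_term b i t)))
     (1 / (w - \<theta>) * (1 / (1 - b / (w powr \<alpha> - \<theta> powr \<alpha>))))"
proof -
  have abs_eq: "\<bar>indicator {0..} t * (exp (- w * t) * series_term b i t)\<bar> =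
      indicator {0..} t * (exp (- w * t) * \<bar>series_term b i t\<bar>)" for i t
    by (simp add: abs_mult indicator_def)
  have abs_term: "\<bar>series_term b i t\<bar> = series_term \<bar>b\<bar> i t" if "0 \<le> t" for i t
    using series_power_nonneg[OF that] series_exponent_nonneg[of i]
    by (simp add: series_term_def abs_mult abs_series_coeff Gamma_real_pos)
  have "has_bochner_integral lborel (\<lambda>t. \<Sum>\<^sub>\<infinity>i. indicator {0..} t * (exp (- w * t) * series_term b i t))
     (\<Sum>\<^sub>\<infinity>i. series_coeff b i / w powr (series_exponent i + 1))"
  proof (rule has_bochner_integral_infsum[OF _ has_bochner_integral_series_term])
    show "(\<lambda>i. \<bar>indicator {0..} t * (exp (- w * t) * series_term b i t)\<bar>) summable_on UNIV" for t
      unfolding abs_eq using abs_summable_series_term[OF b, of t]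
      by (cases "0 \<le> t") (auto intro!: summable_on_cmult_right)
    \<comment> \<open>Absolute values turn b into |b|, so the L1 norms are the terms of the
      transform series at |b|, which converges under the same condition.\<close>
    have "(\<integral>t. \<bar>indicator {0..} t * (exp (- w * t) * series_term b i t)\<bar> \<partial>lborel) =
       series_coeff \<bar>b\<bar> i / w powr (series_exponent i + 1)" for i
    proof -
      have "(\<integral>t. \<bar>indicator {0..} t * (exp (- w * t) * series_term b i t)\<bar> \<partial>lborel) =
        (\<integral>t. indicator {0..} t * (exp (- w * t) * series_term \<bar>b\<bar> i t) \<partial>lborel)"
        by (intro Bochner_Integration.integral_cong) (auto simp: abs_mult abs_term indicator_def)
      then show ?thesis using has_bochner_integral_series_term by (simp add: has_bochner_integral_iff)
    qed
    then show "(\<lambda>i. \<integral>t. \<bar>indicator {0..} t * (exp (- w * t) * series_term b i t)\<bar> \<partial>lborel) summable_on UNIV"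
      using has_sum_series(2)[OF b] by simp
  qed (simp add: finite_prod)
  then show ?thesis using infsumI[OF has_sum_series(1)[OF b]] by (simp add: infsum_cmult_right')
qed

text \<open>Absolute summability over triples allows summation in the nested order. Moving a factor
  out of \<open>suminf\<close> needs the inner series to be summable, which follows from summability
  of the products only if the factor is nonzero; a zero factor makes both sides 0 and is treated
  separately.\<close>

lemma iterated_series:
  assumes b: "\<bar>b\<bar> < w powr \<alpha> - \<theta> powr \<alpha>" and t: "0 \<le> t"
  shows "(\<Sum>q. (\<theta> * t) ^ q * (\<Sum>r. (b * t powr \<alpha>) ^ r *
      ML3 \<alpha> (real r * \<alpha> + real q + 1) (real r) (\<theta> powr \<alpha> * t powr \<alpha>))) = (\<Sum>\<^sub>\<infinity>i. series_term b i t)"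
proof -
  define g where "g i = series_term b i t" for i
  have sum: "g summable_on UNIV"
    using abs_summable_series_term[OF b t] by (intro abs_summable_summable[of g]) (simp add: g_def)
  have sumqr: "(\<lambda>z. g (q, z)) summable_on UNIV" for q
    by (rule summable_on_pairs(1)[OF sum])
  have sumj: "(\<lambda>j. g (q, r, j)) summable_on UNIV" for q r
    by (rule summable_on_pairs(1)[OF sumqr])
  have suminf: "suminf f = infsum f UNIV" if "f summable_on UNIV" for f :: "nat \<Rightarrow> real"
    using has_sum_imp_sums[OF has_sum_infsum[OF that]] by (simp add: sums_iff)
  have J: "(\<theta> * t) ^ q * ((b * t powr \<alpha>) ^ r * ML3 \<alpha> (real r * \<alpha> + real q + 1) (real r) (\<theta> powr \<alpha> * t powr \<alpha>)) =
     (\<Sum>\<^sub>\<infinity>j. g (q, r, j))" for q r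
  proof (cases "(\<theta> * t) ^ q * (b * t powr \<alpha>) ^ r = 0")
    case True
    have "g (q, r, j) = 0" for j
      using True by (auto simp: g_def series_term_def series_power_def series_coeff_def power_add)
    then show ?thesis using True by auto
  next
    case False
    have eq: "g (q, r, j) = (\<theta> * t) ^ q * (b * t powr \<alpha>) ^ r *
       (pochhammer (real r) j * (\<theta> powr \<alpha> * t powr \<alpha>) ^ j / (fact j * Gamma (\<alpha> * real j + (real r * \<alpha> + real q + 1))))" for j
      by (simp add: g_def series_term_def series_power_def series_coeff_def series_exponent_def power_add power_mult_distrib algebra_simps)
    have "(\<Sum>\<^sub>\<infinity>j. g (q, r, j)) = (\<Sum>j. g (q, r, j))" by (rule suminf[OF sumj, symmetric])
    also have "\<dots> = (\<theta> * t) ^ q * (b * t powr \<alpha>) ^ r * ML3 \<alpha> (real r * \<alpha> + real q + 1) (real r) (\<theta> powr \<alpha> * t powr \<alpha>)"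
      unfolding ML3_def eq using summable_on_imp_summable[OF sumj[of q r]] False
      by (intro suminf_mult, unfold eq) (rule summable_mult_D)
    finally show ?thesis by simp
  qed
  have R: "(\<theta> * t) ^ q * (\<Sum>r. (b * t powr \<alpha>) ^ r * ML3 \<alpha> (real r * \<alpha> + real q + 1) (real r) (\<theta> powr \<alpha> * t powr \<alpha>)) =
    (\<Sum>\<^sub>\<infinity>z. g (q, z))" for q
  proof (cases "(\<theta> * t) ^ q = 0")
    case True
    have "g (q, z) = 0" for z
      using True by (cases z) (auto simp: g_def series_term_def series_power_def series_coeff_def power_add)
    then show ?thesis using True by auto
  next
    case False
    have s: "(\<lambda>r. \<Sum>\<^sub>\<infinity>j. g (q, r, j)) summable_on UNIV"
      by (rule summable_on_pairs(2)[OF sumqr])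
    have "(\<Sum>\<^sub>\<infinity>z. g (q, z)) = (\<Sum>\<^sub>\<infinity>r. \<Sum>\<^sub>\<infinity>j. g (q, r, j))"
      by (rule summable_on_pairs(3)[OF sumqr])
    also have "\<dots> = (\<Sum>r. \<Sum>\<^sub>\<infinity>j. g (q, r, j))" by (rule suminf[OF s, symmetric])
    also have "\<dots> = (\<theta> * t) ^ q * (\<Sum>r. (b * t powr \<alpha>) ^ r * ML3 \<alpha> (real r * \<alpha> + real q + 1) (real r) (\<theta> powr \<alpha> * t powr \<alpha>))"
      using summable_on_imp_summable[OF s] False unfolding J[symmetric]
      by (intro suminf_mult) (rule summable_mult_D)
    finally show ?thesis by simp
  qed
  have s: "(\<lambda>q. \<Sum>\<^sub>\<infinity>z. g (q, z)) summable_on UNIV"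
    by (rule summable_on_pairs(2)[OF sum])
  have "(\<Sum>\<^sub>\<infinity>i. g i) = (\<Sum>\<^sub>\<infinity>q. \<Sum>\<^sub>\<infinity>z. g (q, z))"
    by (rule summable_on_pairs(3)[OF sum])
  also have "\<dots> = (\<Sum>q. \<Sum>\<^sub>\<infinity>z. g (q, z))" by (rule suminf[OF s, symmetric])
  finally show ?thesis unfolding R by (simp add: g_def)
qed

end

section \<open>The distribution of the inter-phase times\<close>

context tempered_erlang
begin

lemma tail_P:
  assumes t: "0 \<le> t"
  shows "prob {\<omega>\<in>space M. t < P n \<omega>} = exp (- \<theta> * t) * (\<Sum>q. (\<theta> * t) ^ q * (\<Sum>r. (- \<beta> * t powr \<alpha>) ^ r *
      ML3 \<alpha> (real r * \<alpha> + real q + 1) (real r) (\<theta> powr \<alpha> * t powr \<alpha>)))"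
proof -
  define F where "F t = (\<Sum>\<^sub>\<infinity>i. series_term \<theta> \<alpha> (- \<beta>) i t)" for t
  define T where "T t = prob {\<omega>\<in>space M. t < P n \<omega>}" for t
  \<comment> \<open>Chosen so that \<psi>(w0 - \<theta>) = \<beta> + 1, which lies in the range of
    absolute convergence.\<close>
  define w0 where "w0 = (\<beta> + \<theta> powr \<alpha> + 1) powr (1 / \<alpha>)"
  have "w0 powr \<alpha> = \<beta> + \<theta> powr \<alpha> + 1"
    using alpha_pos beta_pos by (simp add: w0_def powr_powr add_nonneg_nonneg)
  then have w0: "\<theta> powr \<alpha> + \<beta> < w0 powr \<alpha>" by simp
  have "0 \<le> w0" by (simp add: w0_def)
  have "\<theta> < w0"
  proof (rule ccontr)
    assume "\<not> \<theta> < w0"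
    then have "w0 powr \<alpha> \<le> \<theta> powr \<alpha>" using \<open>0 \<le> w0\<close> alpha_pos by (intro powr_mono2) auto
    then show False using w0 beta_pos by simp
  qed
  define s0 where "s0 = w0 - \<theta>"
  have s0: "0 < s0" using \<open>\<theta> < w0\<close> by (simp add: s0_def)
  \<comment> \<open>The weight exp(-s0 t) makes the m-th moment of g in exp(-t) the difference of
    the two transforms at s0 + m, hence within the range of convergence for every m.\<close>
  define g where "g t = indicator {0..} t * (exp (- s0 * t) * (exp (- \<theta> * t) * F t - T t))" for t
  have big: "\<bar>- \<beta>\<bar> < (s0 + real m + \<theta>) powr \<alpha> - \<theta> powr \<alpha>" for m
  proof -
    have "w0 powr \<alpha> \<le> (s0 + real m + \<theta>) powr \<alpha>"
      using \<open>0 \<le> w0\<close> alpha_pos by (intro powr_mono2) (auto simp: s0_def)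
    then show ?thesis using w0 beta_pos by simp
  qed
  have g0: "has_bochner_integral lborel (\<lambda>t. exp (- t) ^ m * g t) 0" for m
  proof -
    define s where "s = s0 + real m"
    have s: "0 < s" using s0 by (simp add: s_def)
    have \<psi>: "0 < \<psi> s" "\<beta> < \<psi> s" using psi_pos[OF s] big[of m] beta_pos by (auto simp: \<psi>_def s_def)
    have "has_bochner_integral lborel (\<lambda>t. indicator {0..} t * (exp (- (s + \<theta>) * t) * F t))
        (1 / s * (1 / (1 - (- \<beta>) / \<psi> s)))"
      unfolding F_def
      using has_bochner_integral_series[OF theta_pos alpha_pos, of "s + \<theta>" "- \<beta>"] s big[of m]
      by (simp add: \<psi>_def s_def)
    moreover have "has_bochner_integral lborel (\<lambda>t. indicator {0..} t * (exp (- s * t) * T t))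
        ((1 - \<beta> / (\<beta> + \<psi> s)) / s)"
      unfolding T_def expectation_exp_P[OF s, of n, symmetric]
      by (rule has_bochner_integral_exp_tail[OF P_measurable _ s]) (simp add: inter_phase_time_def Let_def)
    ultimately have "has_bochner_integral lborel
        (\<lambda>t. indicator {0..} t * (exp (- (s + \<theta>) * t) * F t) - indicator {0..} t * (exp (- s * t) * T t))
        (1 / s * (1 / (1 - (- \<beta>) / \<psi> s)) - (1 - \<beta> / (\<beta> + \<psi> s)) / s)"
      by (rule has_bochner_integral_diff)
    moreover have "1 / s * (1 / (1 - (- \<beta>) / \<psi> s)) - (1 - \<beta> / (\<beta> + \<psi> s)) / s = 0"
    proof -
      have "1 - (- \<beta>) / \<psi> s = (\<beta> + \<psi> s) / \<psi> s" using \<psi> by (simp add: field_simps)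
      moreover have "1 - \<beta> / (\<beta> + \<psi> s) = \<psi> s / (\<beta> + \<psi> s)" using \<psi> beta_pos by (simp add: field_simps)
      ultimately show ?thesis by simp
    qed
    moreover have "exp (- t) ^ m * g t =
        indicator {0..} t * (exp (- (s + \<theta>) * t) * F t) - indicator {0..} t * (exp (- s * t) * T t)" for t
    proof -
      have "exp (- t) ^ m * exp (- s0 * t) = exp (- s * t)"
        by (simp add: s_def exp_of_nat_mult[symmetric] exp_add[symmetric] algebra_simps)
      moreover have "exp (- (s + \<theta>) * t) = exp (- s * t) * exp (- \<theta> * t)"
        by (simp add: exp_add[symmetric] algebra_simps)
      moreover have "exp (- t) ^ m * g t = indicator {0..} t *
          (exp (- t) ^ m * exp (- s0 * t) * (exp (- \<theta> * t) * F t - T t))"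
        by (simp add: g_def)
      ultimately show ?thesis by (simp only:) (simp add: algebra_simps)
    qed
    ultimately show ?thesis by simp
  qed
  \<comment> \<open>Only one-sided continuity is available: the tail of a law may jump, and the
    indicator jumps at 0.\<close>
  have "continuous (at_right t) g"
  proof -
    have w: "\<theta> < s0 + real 0 + \<theta>" using s0 by simp
    have "continuous_on {0..t + 1} F"
      unfolding F_def by (rule continuous_on_series[OF theta_pos alpha_pos w big])
    then have "continuous_on {t..t + 1} F" by (rule continuous_on_subset) (use t in auto)
    then have "(F \<longlongrightarrow> F t) (at_right t)" by (rule continuous_on_Icc_at_rightD) simp
    moreover have "(T \<longlongrightarrow> T t) (at_right t)"
      using right_continuous_tail[OF P_measurable] by (simp add: T_def[abs_def] continuous_within)
    ultimately have "((\<lambda>t. exp (- s0 * t) * (exp (- \<theta> * t) * F t - T t)) \<longlongrightarrow>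
        exp (- s0 * t) * (exp (- \<theta> * t) * F t - T t)) (at_right t)"
      by (intro tendsto_intros)
    moreover have "\<forall>\<^sub>F x in at_right t. exp (- s0 * x) * (exp (- \<theta> * x) * F x - T x) = g x"
      using t by (intro eventually_at_rightI[of t "t + 1"]) (auto simp: g_def)
    moreover have "exp (- s0 * t) * (exp (- \<theta> * t) * F t - T t) = g t"
      using t by (simp add: g_def)
    ultimately show ?thesis
      unfolding continuous_within using tendsto_cong by force
  qed
  moreover have "integrable lborel g" "\<And>m. (\<integral>t. exp (- t) ^ m * g t \<partial>lborel) = 0"
    using g0[of 0] g0 by (simp_all add: has_bochner_integral_iff)
  moreover have g_neg: "g x = 0" if "x < 0" for x
    using that by (simp add: g_def)
  ultimately have "g t = 0" by (blast intro: right_continuous_eq_0)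
  then have "T t = exp (- \<theta> * t) * F t" using t by (simp add: g_def)
  moreover have "F t = (\<Sum>q. (\<theta> * t) ^ q * (\<Sum>r. (- \<beta> * t powr \<alpha>) ^ r *
      ML3 \<alpha> (real r * \<alpha> + real q + 1) (real r) (\<theta> powr \<alpha> * t powr \<alpha>)))"
    unfolding F_def using s0 t big[of 0]
    by (intro iterated_series[OF theta_pos alpha_pos, symmetric]) auto
  ultimately show ?thesis by (simp add: T_def)
qed

end

theorem theorem4p4:
  fixes M :: "'a measure" and k :: nat and lam \<mu> \<theta> \<alpha> :: real
    and X E :: "nat \<Rightarrow> 'a \<Rightarrow> real" and D :: "real \<Rightarrow> 'a \<Rightarrow> real"
  assumes "prob_space M"
    and "k \<ge> 1" and "lam > 0" and "\<mu> > 0" and "\<theta> > 0" and "0 < \<alpha>" and "\<alpha> < 1"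
    and "\<And>n. distributed M lborel (X n) (exponential_density lam)"
    and "\<And>n. distributed M lborel (E n) (exponential_density (real k * \<mu>))"
    and "prob_space.indep_vars M (\<lambda>_. borel)
           (\<lambda>i. case i of Inl n \<Rightarrow> X n | Inr n \<Rightarrow> E n) (UNIV :: (nat + nat) set)"
    and "tempered_stable_subordinator M \<theta> \<alpha> D"
    and "prob_space.indep_set M
           (sigma_sets (space M) (\<Union>n. {X n -` A \<inter> space M | A. A \<in> sets borel}
                                   \<union> {E n -` A \<inter> space M | A. A \<in> sets borel}))
           (sigma_sets (space M) (\<Union>t. {D t -` A \<inter> space M | A. A \<in> sets borel}))"
  shows "prob_space.indep_vars M (\<lambda>_. borel) (inter_phase_time k X E D) UNIV
    \<and> (\<forall>n. distr M borel (inter_phase_time k X E D n) = distr M borel (inter_phase_time k X E D 0))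
    \<and> (\<forall>n. \<forall>t\<ge>0. prob_space.prob M {\<omega> \<in> space M. inter_phase_time k X E D n \<omega> > t}
          = exp (- \<theta> * t) * (\<Sum>q. (\<theta> * t) ^ q *
              (\<Sum>r. (- real k * \<mu> * t powr \<alpha>) ^ r *
                 ML3 \<alpha> (real r * \<alpha> + real q + 1) (real r) (\<theta> powr \<alpha> * t powr \<alpha>))))"
proof -
  interpret prob_space M by fact
  have "indep_vars (\<lambda>_. borel) (\<lambda>n. case Inr n of Inl n \<Rightarrow> X n | Inr n \<Rightarrow> E n) (UNIV :: nat set)"
    by (rule indep_vars_reindex[OF inj_on_subset[OF inj_Inr] indep_vars_subset[OF assms(10)]]) auto
  then have "indep_vars (\<lambda>_. borel) E UNIV" by simp
  then interpret tempered_erlang M \<theta> \<alpha> D k lam "real k * \<mu>" X E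
    using assms(2-9,11,12) by unfold_locales (auto simp: queue_events_def subordinator_events_def)
  show ?thesis using indep_P distr_P tail_P by simp
qed

end
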